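(* Let $R=\begin{pmatrix}2&1\\0&2\end{pmatrix}$, $B=\left\{\begin{pmatrix}0\\0\end{pmatrix},\begin{pmatrix}1\\0\end{pmatrix}\right\}$, and let $\mu_{R,B}$ be the self-affine measure on $\mathbb{R}^2$ generated by $R$ and $B$. For every spectrum $\Lambda$ of $\mu_{R,B}$ we have $D_1^+(\Lambda)\le 2$, and this upper bound is attained by some spectrum of $\mu_{R,B}$. Moreover, for every $s\in[0,2]$ there exists a spectrum $\Lambda$ of $\mu_{R,B}$ with $\dim_{Be}(\Lambda)=1$ and $D_1^+(\Lambda)=s$.
   Context: Self-affine measure: $\mu_{R,B}$ is the unique Borel probability measure on $\mathbb{R}^2$ satisfying $\mu(E)=\sum_{b\in B}\frac{1}{\#B}\,\mu(\varphi_b^{-1}(E))$ for all Borel sets $E\subseteq\mathbb{R}^2$, where $\varphi_b(x)=R^{-1}(x+b)$. Spectrum: a discrete set $\Lambda\subseteq\mathbb{R}^2$ is a spectrum of a Borel probability measure $\mu$ on $\mathbb{R}^2$ if $E(\Lambda)=\{e^{-2\pi i\langle\lambda,x\rangle}:\lambda\in\Lambda\}$ is an orthonormal basis of $L^2(\mu)$. Beurling density and dimension: for a discrete set $\Lambda\subseteq\mathbb{R}^2$ and $r>0$, the upper $r$-Beurling density is $D_r^+(\Lambda)=\limsup_{h\to\infty}\sup_{x\in\mathbb{R}^2}\frac{\#(\Lambda\cap B(x,h))}{h^r}$, where $B(x,h)$ is the open Euclidean ball with center $x$ and radius $h$. The Beurling dimension is $\dim_{Be}(\Lambda)=\inf\{r>0: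 D_r^+(\Lambda)=0\}=\sup\{r>0: D_r^+(\Lambda)=\infty\}$ (with the supremum of the empty set taken to be $0$). *)

theory Defs
  imports "HOL-Analysis.Analysis" "HOL-Probability.Probability_Measure"
begin

section \<open>Self-affine measures\<close>

definition is_self_affine_measure ::
  "real^2^2 \<Rightarrow> (real^2) set \<Rightarrow> (real^2) measure \<Rightarrow> bool" where
  "is_self_affine_measure R B \<mu> \<longleftrightarrow>
     prob_space \<mu> \<and> sets \<mu> = sets borel \<and>
     (\<forall>E\<in>sets borel.
        measure \<mu> E =
          (\<Sum>b\<in>B. 1 / real (card B) * measure \<mu> ((\<lambda>x. matrix_inv R *v (x + b)) -` E)))"

definition self_affine_measure :: "real^2^2 \<Rightarrow> (real^2) set \<Rightarrow> (real^2) measure" where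
  "self_affine_measure R B = (THE \<mu>. is_self_affine_measure R B \<mu>)"

section \<open>Spectra\<close>

text \<open>
  Elements of $L^2$ are represented by functions rather than by classes of functions that agree
  almost everywhere.
\<close>

definition in_L2 :: "'a measure \<Rightarrow> ('a \<Rightarrow> complex) \<Rightarrow> bool" where
  "in_L2 M f \<longleftrightarrow> f \<in> borel_measurable M \<and> integrable M (\<lambda>x. (cmod (f x))^2)"

definition inner_L2 :: "'a measure \<Rightarrow> ('a \<Rightarrow> complex) \<Rightarrow> ('a \<Rightarrow> complex) \<Rightarrow> complex" where
  "inner_L2 M f g = (\<integral>x. f x * cnj (g x) \<partial>M)"

definition norm_L2 :: "'a measure \<Rightarrow> ('a \<Rightarrow> complex) \<Rightarrow> real" where
  "norm_L2 M f = sqrt (\<integral>x. (cmod (f x))^2 \<partial>M)"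

text \<open>
  An orthonormal basis is an orthonormal family whose linear span is dense. Since it is a family,
  distinct indices must give orthogonal (hence almost everywhere different) functions.
\<close>

definition orthonormal_basis_L2 :: "'a measure \<Rightarrow> 'i set \<Rightarrow> ('i \<Rightarrow> 'a \<Rightarrow> complex) \<Rightarrow> bool" where
  "orthonormal_basis_L2 M I e \<longleftrightarrow>
     (\<forall>i\<in>I. in_L2 M (e i)) \<and>
     (\<forall>i\<in>I. \<forall>j\<in>I. inner_L2 M (e i) (e j) = (if i = j then 1 else 0)) \<and>
     (\<forall>f. in_L2 M f \<longrightarrow>
        (\<forall>\<epsilon>>0. \<exists>F c. finite F \<and> F \<subseteq> I \<and>
           norm_L2 M (\<lambda>x. f x - (\<Sum>i\<in>F. c i * e i x)) < \<epsilon>))"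

definition exponential :: "real^2 \<Rightarrow> real^2 \<Rightarrow> complex" where
  "exponential \<xi> x = exp (- 2 * complex_of_real pi * \<i> * complex_of_real (\<xi> \<bullet> x))"

definition is_spectrum :: "(real^2) measure \<Rightarrow> (real^2) set \<Rightarrow> bool" where
  "is_spectrum \<mu> \<Lambda> \<longleftrightarrow> discrete \<Lambda> \<and> orthonormal_basis_L2 \<mu> \<Lambda> exponential"

section \<open>Beurling density and Beurling dimension\<close>

text \<open>
  Points are counted with the counting measure, which (unlike \<^const>\<open>card\<close>) gives \<open>\<infinity>\<close> on
  infinite sets: a discrete set may have an accumulation point outside itself.
\<close>

definition upper_beurling_density :: "real \<Rightarrow> (real^2) set \<Rightarrow> ennreal" where
  "upper_beurling_density r \<Lambda> =
     Limsup at_top (\<lambda>h::real.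
       SUP x. emeasure (count_space UNIV) (\<Lambda> \<inter> ball x h) / ennreal (h powr r))"

definition beurling_dim :: "(real^2) set \<Rightarrow> ennreal" where
  "beurling_dim \<Lambda> = Inf {ennreal r | r. r > 0 \<and> upper_beurling_density r \<Lambda> = 0}"

lemma upper_beurling_density_eq_0:
  assumes "upper_beurling_density r \<Lambda> < \<infinity>" and "r < r'"
  shows "upper_beurling_density r' \<Lambda> = 0"
proof -
  define G where
    "G r h = (SUP x. emeasure (count_space UNIV) (\<Lambda> \<inter> ball x h) / ennreal (h powr r))" for r h
  have D: "upper_beurling_density s \<Lambda> = Limsup at_top (G s)" for s
    unfolding upper_beurling_density_def G_def ..
  obtain c where c: "Limsup at_top (G r) < c" "c < \<infinity>"
    using assms(1) unfolding D using dense by blast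
  then obtain C where C: "Limsup at_top (G r) < ennreal C"
    by (cases c) auto
  have ev: "eventually (\<lambda>h. G r h < ennreal C) at_top"
    using C by (rule Limsup_lessD)
  have "eventually (\<lambda>h. G r' h \<le> ennreal (C * h powr (r - r'))) at_top"
    using ev eventually_gt_at_top[of 0]
  proof eventually_elim
    case (elim h)
    show ?case unfolding G_def
    proof (rule SUP_least)
      fix x
      let ?m = "emeasure (count_space UNIV) (\<Lambda> \<inter> ball x h)"
      have le: "?m / ennreal (h powr r) \<le> ennreal C"
        using elim(1) unfolding G_def by (meson SUP_upper UNIV_I less_imp_le order_trans)
      have "C > 0" using elim(1) by (cases "C > 0") (auto simp: ennreal_neg)
      have pos: "h powr r > 0" "h powr r' > 0" using elim(2) by simp_all
      have "inverse (ennreal (h powr r')) = ennreal (inverse (h powr r'))"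
        using pos by (simp add: inverse_ennreal)
      also have "inverse (h powr r') = inverse (h powr r) * h powr (r - r')"
        using pos by (simp add: powr_diff divide_inverse)
      also have "ennreal \<dots> = inverse (ennreal (h powr r)) * ennreal (h powr (r - r'))"
        using pos by (simp add: inverse_ennreal ennreal_mult)
      finally have "?m / ennreal (h powr r') = ?m / ennreal (h powr r) * ennreal (h powr (r - r'))"
        by (simp add: divide_ennreal_def mult.assoc)
      also have "\<dots> \<le> ennreal C * ennreal (h powr (r - r'))"
        by (intro mult_right_mono le) simp
      finally show "?m / ennreal (h powr r') \<le> ennreal (C * h powr (r - r'))"
        using \<open>C > 0\<close> by (simp add: ennreal_mult)
    qed
  qed
  then have "Limsup at_top (G r') \<le> Limsup at_top (\<lambda>h. ennreal (C * h powr (r - r')))"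
    by (rule Limsup_mono)
  moreover have "((\<lambda>h. ennreal (C * h powr (r - r'))) \<longlongrightarrow> ennreal (C * 0)) at_top"
    using assms(2) by (intro tendsto_ennrealI tendsto_mult tendsto_const tendsto_neg_powr)
      (auto intro: filterlim_ident)
  then have "Limsup at_top (\<lambda>h. ennreal (C * h powr (r - r'))) = 0"
    by (simp add: lim_imp_Limsup)
  ultimately show ?thesis unfolding D by simp
qed

lemma beurling_dim_eq_Sup:
  "beurling_dim \<Lambda> = Sup {ennreal r | r. r > 0 \<and> upper_beurling_density r \<Lambda> = \<infinity>}"
    (is "_ = Sup ?S")
proof (rule antisym)
  show "beurling_dim \<Lambda> \<le> Sup ?S"
  proof (rule ccontr)
    assume "\<not> ?thesis"
    then have "Sup ?S < beurling_dim \<Lambda>" by (rule not_le_imp_less)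
    from dense[OF this] obtain a where a: "Sup ?S < a" "a < beurling_dim \<Lambda>" by (elim exE conjE)
    from dense[OF a(2)] obtain b where b: "a < b" "b < beurling_dim \<Lambda>" by (elim exE conjE)
    obtain r where r: "a = ennreal r" "r \<ge> 0" using a by (cases a) auto
    obtain r' where r': "b = ennreal r'" "r' \<ge> 0" using b by (cases b) auto
    have "r < r'" using b r r' by (simp add: ennreal_less_iff)
    moreover have "r > 0" using a(1) r by (cases "r = 0") auto
    moreover have "ennreal r \<notin> ?S" using Sup_upper[of "ennreal r" ?S] a(1) unfolding r(1) by (meson leD)
    ultimately have "upper_beurling_density r' \<Lambda> = 0"
      by (intro upper_beurling_density_eq_0[of r]) (auto simp: less_top)
    then have "beurling_dim \<Lambda> \<le> ennreal r'"
      unfolding beurling_dim_def using \<open>r > 0\<close> \<open>r < r'\<close> by (intro Inf_lower) auto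
    then show False using b r' by simp
  qed
next
  have "r \<le> r'" if "upper_beurling_density r \<Lambda> = \<infinity>" "upper_beurling_density r' \<Lambda> = 0" for r r'
    using that upper_beurling_density_eq_0[of r' \<Lambda> r] by fastforce
  then show "Sup ?S \<le> beurling_dim \<Lambda>"
    unfolding beurling_dim_def by (intro Sup_least Inf_greatest) (auto intro!: ennreal_leI)
qed

end

theory Submission
  imports Defs "HOL-Probability.Distribution_Functions" "HOL-Real_Asymp.Real_Asymp"
begin

text \<open>
  Both contractions map the first coordinate axis into itself and halve the second coordinate, so the
  self-affine measure is the law of \<open>(t, 0)\<close> with \<open>t\<close> uniform on the unit interval. Hence only first
  coordinates of frequencies matter: orthogonality forces them to differ by nonzero integers, which
  bounds the number of points in a ball of radius \<open>h\<close> by \<open>2h + 1\<close>; conversely, since trigonometric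
  polynomials are dense, the graph of every function from the integers to the reals is a spectrum.
  The graph of \<open>n \<mapsto> cn\<close> has density \<open>2 / sqrt (1 + c\<^sup>2)\<close>, which takes all values in \<open>(0, 2]\<close>, and the
  graph of \<open>n \<mapsto> n ln (1 + \<bar>n\<bar>)\<close> has density zero but dimension one.
\<close>

section \<open>Counting points and Beurling density\<close>

text \<open>That \<open>t\<close> is uniform reflects binary expansion: on the axis the maps are t
  -> t/2 and t -> (t+1)/2, since the off-diagonal entry of the inverse matrix only ever multiplies a
  second coordinate. As \<open>self_affine_measure\<close> is a definite description, uniqueness has
  to be proved too; it comes from distribution functions, one coordinate at a time, the second being
  disposed of before the first.

  Density of trigonometric polynomials meets an obstacle: they are functions on the circle, which
  glues the endpoints of the unit interval. Stone-Weierstrass thus reaches only functions pulled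
  back from the circle; measurable inversion of the circle map and approximation of indicators carry
  the result over to the interval.

  The density of a line comes from comparing the spacing sqrt (1 + c^2) of its points with the
  diameter 2h of a ball. No line gives the value 0: the slopes have to tend to infinity, but more
  slowly than any power, so that the dimension stays 1.\<close>

lemma card_int_diameter_le:
  fixes A :: "int set"
  assumes d: "\<And>m n. m \<in> A \<Longrightarrow> n \<in> A \<Longrightarrow> real_of_int (m - n) \<le> d" and "d \<ge> 0"
  shows "finite A" "real (card A) \<le> d + 1"
proof -
  have "finite A \<and> real (card A) \<le> d + 1"
  proof (cases "A = {}")
    case False
    then obtain a where a: "a \<in> A" by auto
    have "A \<subseteq> {a - \<lfloor>d\<rfloor>..a + \<lfloor>d\<rfloor>}"
    proof
      fix n assume n: "n \<in> A"
      have "n - a \<le> \<lfloor>d\<rfloor>" "a - n \<le> \<lfloor>d\<rfloor>" using d[OF n a] d[OF a n] by (auto simp: le_floor_iff)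
      then show "n \<in> {a - \<lfloor>d\<rfloor>..a + \<lfloor>d\<rfloor>}" by auto
    qed
    then have fin: "finite A" by (rule finite_subset) auto
    have "A \<subseteq> {Min A..Max A}" using fin by auto
    then have "card A \<le> card {Min A..Max A}" by (intro card_mono) auto
    moreover have "Min A \<le> Max A" using fin a by (meson Max_ge Min_le order_trans)
    ultimately have "real (card A) \<le> real_of_int (Max A - Min A) + 1" by simp
    also have "real_of_int (Max A - Min A) \<le> d" using False fin by (intro d) auto
    finally show ?thesis using fin by simp
  qed (use \<open>d \<ge> 0\<close> in auto)
  then show "finite A" "real (card A) \<le> d + 1" by auto
qed

text \<open>Because of the supremum over centres, \<open>C h\<close> has to serve all of them at
  once. Finiteness is demanded explicitly since \<open>card\<close> is 0 on infinite sets, where the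
  counting measure is infinite.\<close>

lemma upper_beurling_density_le:
  assumes lim: "((\<lambda>h. C h / h powr r) \<longlongrightarrow> l) at_top"
    and count: "\<And>h x. h > 0 \<Longrightarrow> finite (\<Lambda> \<inter> ball x h) \<and> real (card (\<Lambda> \<inter> ball x h)) \<le> C h"
  shows "upper_beurling_density r \<Lambda> \<le> ennreal l"
proof -
  have "eventually (\<lambda>h. (SUP x. emeasure (count_space UNIV) (\<Lambda> \<inter> ball x h) / ennreal (h powr r))
      \<le> ennreal (C h / h powr r)) at_top"
    using eventually_gt_at_top[of 0]
  proof eventually_elim
    case (elim h)
    show ?case
    proof (rule SUP_least)
      fix x
      have "emeasure (count_space UNIV) (\<Lambda> \<inter> ball x h) = ennreal (real (card (\<Lambda> \<inter> ball x h)))"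
        using count[OF elim, of x] by (simp add: ennreal_of_nat_eq_real_of_nat)
      then show "emeasure (count_space UNIV) (\<Lambda> \<inter> ball x h) / ennreal (h powr r) \<le> ennreal (C h / h powr r)"
        using count[OF elim, of x] elim by (simp add: divide_ennreal divide_right_mono)
    qed
  qed
  then have "upper_beurling_density r \<Lambda> \<le> Limsup at_top (\<lambda>h. ennreal (C h / h powr r))"
    unfolding upper_beurling_density_def by (rule Limsup_mono)
  also have "\<dots> = ennreal l"
    using lim by (intro lim_imp_Limsup tendsto_ennrealI) auto
  finally show ?thesis .
qed

text \<open>For a lower bound one well-chosen centre per radius suffices, since the supremum
  dominates its value there.\<close>

lemma upper_beurling_density_ge:
  assumes lim: "((\<lambda>h. c h / h powr r) \<longlongrightarrow> l) at_top"
    and count: "\<And>h. h > 0 \<Longrightarrow> \<exists>x. ennreal (c h) \<le> emeasure (count_space UNIV) (\<Lambda> \<inter> ball x h)"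
  shows "ennreal l \<le> upper_beurling_density r \<Lambda>"
proof -
  have "eventually (\<lambda>h. ennreal (c h / h powr r) \<le>
      (SUP x. emeasure (count_space UNIV) (\<Lambda> \<inter> ball x h) / ennreal (h powr r))) at_top"
    using eventually_gt_at_top[of 0]
  proof eventually_elim
    case (elim h)
    then obtain x where x: "ennreal (c h) \<le> emeasure (count_space UNIV) (\<Lambda> \<inter> ball x h)"
      using count by auto
    have "ennreal (c h / h powr r) = ennreal (c h) / ennreal (h powr r)"
    \<comment> \<open>A bound such as \<open>2 * h / L - 1\<close> is negative for small
      \<open>h\<close>; \<open>ennreal\<close> then truncates both sides to 0.\<close>
    proof (cases "c h \<ge> 0")
      case False
      then have "c h / h powr r \<le> 0" using elim by (simp add: divide_nonpos_pos)
      then show ?thesis using False by (simp add: ennreal_neg)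
    qed (use elim in \<open>simp add: divide_ennreal\<close>)
    also have "\<dots> \<le> emeasure (count_space UNIV) (\<Lambda> \<inter> ball x h) / ennreal (h powr r)"
      using x by (rule divide_right_mono_ennreal)
    finally show ?case by (rule order_trans) (rule SUP_upper, simp)
  qed
  then have "Limsup at_top (\<lambda>h. ennreal (c h / h powr r)) \<le> upper_beurling_density r \<Lambda>"
    unfolding upper_beurling_density_def by (rule Limsup_mono)
  moreover have "Limsup at_top (\<lambda>h. ennreal (c h / h powr r)) = ennreal l"
    using lim by (intro lim_imp_Limsup tendsto_ennrealI) auto
  ultimately show ?thesis by simp
qed

text \<open>Finiteness at exponent 1 makes every density at exponent 1 + e vanish, while
  \<open>nz\<close> keeps all exponents below 1 out of the defining infimum. The density at exponent
  1 may itself be 0, as it is for \<open>nlogn\<close>.\<close>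

lemma beurling_dim_eq_1:
  assumes fin: "upper_beurling_density 1 \<Lambda> < \<infinity>"
    and nz: "\<And>r. 0 < r \<Longrightarrow> r < 1 \<Longrightarrow> upper_beurling_density r \<Lambda> \<noteq> 0"
  shows "beurling_dim \<Lambda> = 1"
proof (rule antisym)
  show "beurling_dim \<Lambda> \<le> 1"
  proof (rule ennreal_le_epsilon)
    fix e :: real assume "e > 0"
    then have "upper_beurling_density (1 + e) \<Lambda> = 0"
      using fin by (intro upper_beurling_density_eq_0[of 1]) auto
    then have "beurling_dim \<Lambda> \<le> ennreal (1 + e)"
      unfolding beurling_dim_def using \<open>e > 0\<close>
      by (intro Inf_lower CollectI exI[of _ "1 + e"]) (auto simp del: ennreal_plus)
    then show "beurling_dim \<Lambda> \<le> 1 + ennreal e" using \<open>e > 0\<close> by simp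
  qed
  show "1 \<le> beurling_dim \<Lambda>"
    unfolding beurling_dim_def
  proof (rule Inf_greatest)
    fix z assume "z \<in> {ennreal r |r. 0 < r \<and> upper_beurling_density r \<Lambda> = 0}"
    then obtain r where "z = ennreal r" "0 < r" "upper_beurling_density r \<Lambda> = 0" by auto
    then show "1 \<le> z" using nz[of r] by (cases "r < 1") (auto simp flip: ennreal_1 intro!: ennreal_leI)
  qed
qed

section \<open>Graphs of functions on the integers\<close>

definition graph_set :: "(int \<Rightarrow> real) \<Rightarrow> (real^2) set" where
  "graph_set f = range (\<lambda>n. vector [real_of_int n, f n])"

lemma norm_vector_2: "norm (vector [a, b] :: real^2) = sqrt (a\<^sup>2 + b\<^sup>2)"
  by (simp add: norm_vec_def L2_set_def sum_2)

lemma vector_2_diff: "(vector [a, b] :: real^2) - vector [c, d] = vector [a - c, b - d]"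
  by (simp add: vec_eq_iff forall_2)

lemma inj_graph: "inj (\<lambda>n. vector [real_of_int n, f n] :: real^2)"
proof (rule injI)
  fix m n assume "(vector [real_of_int m, f m] :: real^2) = vector [real_of_int n, f n]"
  then have "(vector [real_of_int m, f m] :: real^2) $ 1 = vector [real_of_int n, f n] $ 1" by simp
  then show "m = n" by simp
qed

lemma graph_set_Int_ball:
  "graph_set f \<inter> ball x h = (\<lambda>n. vector [real_of_int n, f n]) ` {n. vector [real_of_int n, f n] \<in> ball x h}"
  by (auto simp: graph_set_def)

lemma card_graph_set_Int_ball:
  "card (graph_set f \<inter> ball x h) = card {n. vector [real_of_int n, f n] \<in> ball x h}"
  unfolding graph_set_Int_ball by (rule card_image) (rule inj_on_subset[OF inj_graph subset_UNIV])

lemma finite_graph_set_Int_ball: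
  "finite (graph_set f \<inter> ball x h) \<longleftrightarrow> finite {n. vector [real_of_int n, f n] \<in> ball x h}"
  unfolding graph_set_Int_ball by (rule finite_image_iff) (rule inj_on_subset[OF inj_graph subset_UNIV])

lemma discrete_graph_set: "discrete (graph_set f)"
proof (rule discreteI)
  fix p assume p: "p \<in> graph_set f"
  \<comment> \<open>Distinct points have first coordinates at least 1 apart, so unit balls isolate
    them.\<close>
  have "q = p" if q: "q \<in> graph_set f" "q \<in> ball p 1" for q
  proof -
    obtain m n where mn: "p = vector [real_of_int m, f m]" "q = vector [real_of_int n, f n]"
      using q(1) p unfolding graph_set_def by blast
    have "\<bar>(p - q) $ 1\<bar> < 1"
      using q component_le_norm_cart[of "p - q" 1] by (simp add: dist_norm)
    then have "m = n" by (simp add: mn)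
    then show ?thesis by (simp add: mn)
  qed
  then have "ball p 1 \<inter> graph_set f = {p}" using p by auto
  then show "p isolated_in graph_set f" unfolding isolated_in_def using p by blast
qed

lemma dist_less_in_ball: "p \<in> ball x h \<Longrightarrow> q \<in> ball x h \<Longrightarrow> dist p q < 2 * h"
  using dist_triangle[of p q x] by (simp add: dist_commute)

text \<open>Neighbouring points are \<open>L = sqrt (1 + c\<^sup>2)\<close> apart on a straight
  line, so any open ball of radius h holds at most 2h/L + 1 of them, and the ball around the origin
  holds at least 2h/L - 1.\<close>

lemma upper_beurling_density_line:
  fixes c :: real
  shows "upper_beurling_density 1 (graph_set (\<lambda>n. c * real_of_int n)) = ennreal (2 / sqrt (1 + c\<^sup>2))"
proof -
  define L where "L = sqrt (1 + c\<^sup>2)"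
  have "L > 0" by (simp add: L_def add_pos_nonneg)
  have norm_line: "norm (vector [t, c * t] :: real^2) = L * \<bar>t\<bar>" for t
  proof -
    have "t\<^sup>2 + (c * t)\<^sup>2 = (1 + c\<^sup>2) * t\<^sup>2" by (simp add: power_mult_distrib algebra_simps)
    then show ?thesis by (simp add: norm_vector_2 L_def real_sqrt_mult)
  qed
  let ?A = "\<lambda>x h. {n. vector [real_of_int n, c * real_of_int n] \<in> ball (x :: real^2) h}"
  have upper: "finite (?A x h)" "real (card (?A x h)) \<le> 2 * h / L + 1" if "h > 0" for x h
  proof -
    have d: "real_of_int (m - n) \<le> 2 * h / L" if mn: "m \<in> ?A x h" "n \<in> ?A x h" for m n
    proof -
      have "vector [real_of_int m, c * real_of_int m] - vector [real_of_int n, c * real_of_int n]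
          = (vector [real_of_int (m - n), c * real_of_int (m - n)] :: real^2)"
        by (simp add: vector_2_diff right_diff_distrib)
      then have *: "dist (vector [real_of_int m, c * real_of_int m]) (vector [real_of_int n, c * real_of_int n] :: real^2)
          = L * \<bar>real_of_int (m - n)\<bar>"
        unfolding dist_norm by (simp only: norm_line)
      have "L * \<bar>real_of_int (m - n)\<bar> < 2 * h"
        using mn unfolding *[symmetric] mem_Collect_eq by (rule dist_less_in_ball)
      then have "\<bar>real_of_int (m - n)\<bar> < 2 * h / L" using \<open>L > 0\<close> by (simp add: field_simps)
      then show ?thesis by linarith
    qed
    show "finite (?A x h)" "real (card (?A x h)) \<le> 2 * h / L + 1"
      using card_int_diameter_le[of "?A x h", OF d] \<open>h > 0\<close> \<open>L > 0\<close> by auto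
  qed
  have lower: "ennreal (2 * h / L - 1) \<le>
      emeasure (count_space UNIV) (graph_set (\<lambda>n. c * real_of_int n) \<inter> ball 0 h)" if "h > 0" for h
  proof -
    \<comment> \<open>The largest integer strictly below h/L; strictness is forced by the open ball.
      The 2k + 1 integers from -k to k give the bound, as k is at least h/L - 1.\<close>
    define k where "k = \<lceil>h / L\<rceil> - 1"
    have k: "real_of_int k < h / L" "h / L \<le> real_of_int k + 1" unfolding k_def by linarith+
    have "k \<ge> 0" using \<open>h > 0\<close> \<open>L > 0\<close> by (simp add: k_def less_ceiling_iff flip: int_one_le_iff_zero_less)
    have "{-k..k} \<subseteq> ?A 0 h"
    proof
      fix n assume "n \<in> {-k..k}"
      then have "\<bar>real_of_int n\<bar> < h / L" using k by auto
      then show "n \<in> ?A 0 h" using \<open>L > 0\<close> norm_line[of "real_of_int n"] by (simp add: field_simps)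
    qed
    then have "card {-k..k} \<le> card (?A 0 h)" by (rule card_mono[OF upper(1)[OF that]])
    then have "2 * h / L - 1 \<le> real (card (?A 0 h))" using k \<open>k \<ge> 0\<close> by simp
    then show ?thesis using upper[OF that, of 0]
      by (simp add: finite_graph_set_Int_ball card_graph_set_Int_ball ennreal_of_nat_eq_real_of_nat ennreal_leI)
  qed
  have "upper_beurling_density 1 (graph_set (\<lambda>n. c * real_of_int n)) \<le> ennreal (2 / L)"
  proof (rule upper_beurling_density_le)
    show "((\<lambda>h. (2 * h / L + 1) / h powr 1) \<longlongrightarrow> 2 / L) at_top"
      unfolding divide_inverse[of 2 L] using \<open>L > 0\<close> by real_asymp
  qed (use upper in \<open>auto simp: finite_graph_set_Int_ball card_graph_set_Int_ball\<close>)
  moreover have "ennreal (2 / L) \<le> upper_beurling_density 1 (graph_set (\<lambda>n. c * real_of_int n))"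
  proof (rule upper_beurling_density_ge)
    show "((\<lambda>h. (2 * h / L - 1) / h powr 1) \<longlongrightarrow> 2 / L) at_top"
      unfolding divide_inverse[of 2 L] using \<open>L > 0\<close> by real_asymp
  qed (use lower in blast)
  ultimately show ?thesis by (simp add: L_def antisym)
qed

text \<open>A vanishing density at an exponent below 1 would force density 0 at exponent 1, where
  the line has a positive value.\<close>

lemma beurling_dim_line: "beurling_dim (graph_set (\<lambda>n. c * real_of_int n)) = 1"
proof (rule beurling_dim_eq_1)
  have pos: "2 / sqrt (1 + c\<^sup>2) > 0" by (simp add: add_pos_nonneg)
  show "upper_beurling_density 1 (graph_set (\<lambda>n. c * real_of_int n)) < \<infinity>"
    by (simp add: upper_beurling_density_line)
  show "upper_beurling_density r (graph_set (\<lambda>n. c * real_of_int n)) \<noteq> 0" if "r < 1" for r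
    using upper_beurling_density_eq_0[of r "graph_set (\<lambda>n. c * real_of_int n)" 1] that pos
    by (auto simp: upper_beurling_density_line ennreal_eq_0_iff)
qed

text \<open>
  Its gaps tend to infinity, so the density for exponent one vanishes; as they grow only
  logarithmically, no smaller exponent suffices.
\<close>

definition nlogn :: "int \<Rightarrow> real" where
  "nlogn n = real_of_int n * ln (1 + \<bar>real_of_int n\<bar>)"

text \<open>Chords beyond \<open>M\<close> have slope at least ln (1 + M): replacing ln (1 + n) by
  the smaller ln (1 + m) in the first term leaves exactly a multiple of n - m.\<close>

lemma nlogn_diff_ge:
  assumes "0 \<le> M" "M \<le> m" "m \<le> n"
  shows "nlogn n - nlogn m \<ge> ln (1 + real_of_int M) * real_of_int (n - m)"
proof -
  have "nlogn n - nlogn m = real_of_int n * (ln (1 + real_of_int n) - ln (1 + real_of_int m))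
      + ln (1 + real_of_int m) * real_of_int (n - m)"
    using assms by (simp add: nlogn_def algebra_simps)
  moreover have "real_of_int n * (ln (1 + real_of_int n) - ln (1 + real_of_int m)) \<ge> 0"
    using assms by (intro mult_nonneg_nonneg) auto
  moreover have "ln (1 + real_of_int M) * real_of_int (n - m) \<le> ln (1 + real_of_int m) * real_of_int (n - m)"
    using assms by (intro mult_right_mono) auto
  ultimately show ?thesis by linarith
qed

lemma nlogn_minus: "nlogn (- n) = - nlogn n"
  by (simp add: nlogn_def)

text \<open>The indices are split at -M and M. The middle block has 2M + 1 of them; on each tail the
  second coordinates differ by less than 2h while the slope is at least ln (1 + M), so the indices
  spread over at most 2h / ln (1 + M). The negative tail follows from the positive one because
  \<open>nlogn\<close> is odd.\<close>

lemma count_nlogn_le: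
  assumes "M \<ge> 1" "h > 0"
  shows "finite (graph_set nlogn \<inter> ball x h)"
    "real (card (graph_set nlogn \<inter> ball x h)) \<le> (2 * real_of_int M + 1) + 2 * (2 * h / ln (1 + real_of_int M) + 1)"
proof -
  define A where "A = {n. vector [real_of_int n, nlogn n] \<in> ball x h}"
  define l where "l = ln (1 + real_of_int M)"
  have "l > 0" using assms by (simp add: l_def)
  have near: "\<bar>nlogn m - nlogn n\<bar> < 2 * h" if "m \<in> A" "n \<in> A" for m n
  proof -
    have "norm (vector [real_of_int m, nlogn m] - vector [real_of_int n, nlogn n] :: real^2) < 2 * h"
      using dist_less_in_ball[of _ x h] that by (simp add: A_def dist_norm)
    then show ?thesis
      using component_le_norm_cart[of "vector [real_of_int m, nlogn m] - vector [real_of_int n, nlogn n] :: real^2" 2]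
      by simp
  qed
  have nonneg: "2 * h / l \<ge> 0" using \<open>l > 0\<close> assms by simp
  have pos: "real_of_int (m - n) \<le> 2 * h / l" if "m \<in> A \<inter> {M..}" "n \<in> A \<inter> {M..}" for m n
  proof (cases "n \<le> m")
    case True
    then have "l * real_of_int (m - n) \<le> 2 * h"
      using nlogn_diff_ge[of M n m] that assms near[of m n] by (simp add: l_def)
    then show ?thesis using \<open>l > 0\<close> by (simp add: field_simps)
  next
    case False
    then have "real_of_int (m - n) \<le> 0" by simp
    then show ?thesis using nonneg by linarith
  qed
  have neg: "real_of_int (m - n) \<le> 2 * h / l" if "m \<in> A \<inter> {..-M}" "n \<in> A \<inter> {..-M}" for m n
  proof (cases "n \<le> m")
    case True
    then have "l * real_of_int (m - n) \<le> 2 * h"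
      using nlogn_diff_ge[of M "-m" "-n"] that assms near[of m n] by (simp add: l_def nlogn_minus)
    then show ?thesis using \<open>l > 0\<close> by (simp add: field_simps)
  next
    case False
    then have "real_of_int (m - n) \<le> 0" by simp
    then show ?thesis using nonneg by linarith
  qed
  note pos' = card_int_diameter_le[of "A \<inter> {M..}", OF pos nonneg]
  note neg' = card_int_diameter_le[of "A \<inter> {..-M}", OF neg nonneg]
  have A: "A \<subseteq> {-M..M} \<union> ((A \<inter> {M..}) \<union> (A \<inter> {..-M}))" by auto
  then have fin: "finite A" by (rule finite_subset) (use pos' neg' in auto)
  have "card A \<le> card ({-M..M} \<union> ((A \<inter> {M..}) \<union> (A \<inter> {..-M})))"
    using A by (rule card_mono[rotated]) (use pos' neg' in auto)
  also have "\<dots> \<le> card {-M..M} + (card (A \<inter> {M..}) + card (A \<inter> {..-M}))"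
    by (meson card_Un_le add_left_mono order_trans)
  finally have "real (card A) \<le> real (card {-M..M}) + (real (card (A \<inter> {M..})) + real (card (A \<inter> {..-M})))"
    by linarith
  then have "real (card A) \<le> (2 * real_of_int M + 1) + 2 * (2 * h / l + 1)"
    using pos'(2) neg'(2) assms by simp
  then show "finite (graph_set nlogn \<inter> ball x h)"
    "real (card (graph_set nlogn \<inter> ball x h)) \<le> (2 * real_of_int M + 1) + 2 * (2 * h / ln (1 + real_of_int M) + 1)"
    using fin by (auto simp: A_def l_def finite_graph_set_Int_ball card_graph_set_Int_ball)
qed

text \<open>With \<open>M = Suc k\<close> fixed, letting h tend to infinity removes the constant
  terms of the count and leaves 4 / ln (1 + M), two tails contributing 2h each; only afterwards does
  M grow.\<close>

lemma upper_beurling_density_nlogn: "upper_beurling_density 1 (graph_set nlogn) = 0"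
proof -
  have "upper_beurling_density 1 (graph_set nlogn) \<le> ennreal (4 / ln (1 + real_of_int (int (Suc k))))" for k
  proof (rule upper_beurling_density_le)
    define l where "l = ln (1 + real_of_int (int (Suc k)))"
    have "l > 0" by (simp add: l_def)
    then have "((\<lambda>h. ((2 * real_of_int (int (Suc k)) + 1) + 2 * (2 * h / l + 1)) / h powr 1) \<longlongrightarrow> 4 * inverse l) at_top"
      by real_asymp
    then show "((\<lambda>h. ((2 * real_of_int (int (Suc k)) + 1) + 2 * (2 * h / ln (1 + real_of_int (int (Suc k))) + 1))
      / h powr 1) \<longlongrightarrow> 4 / ln (1 + real_of_int (int (Suc k)))) at_top"
      unfolding l_def divide_inverse .
  qed (use count_nlogn_le[of "int (Suc k)"] in simp)
  moreover have "(\<lambda>k. ennreal (4 / ln (1 + real_of_int (int (Suc k))))) \<longlonglongrightarrow> ennreal 0"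
    by (rule tendsto_ennrealI) (simp, real_asymp)
  ultimately have "upper_beurling_density 1 (graph_set nlogn) \<le> ennreal 0"
    by (intro LIMSEQ_le_const) auto
  then show ?thesis by simp
qed

lemma beurling_dim_nlogn: "beurling_dim (graph_set nlogn) = 1"
proof (rule beurling_dim_eq_1)
  show "upper_beurling_density 1 (graph_set nlogn) < \<infinity>" by (simp add: upper_beurling_density_nlogn)
  fix r :: real assume r: "0 < r" "r < 1"
  \<comment> \<open>The points with indices 1 to N have norm at most N (1 + ln (1 + N)); the factor
    N + 1 in place of N puts them strictly inside the open ball. For r < 1 the quotient N / (h N)^r
    still tends to infinity, which contradicts density 0 along these radii.\<close>
  define h where "h N = (real N + 1) * (1 + ln (1 + real N))" for N
  have h_pos: "h N > 0" for N by (simp add: h_def add_pos_nonneg)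
  show "upper_beurling_density r (graph_set nlogn) \<noteq> 0"
  proof
    assume "upper_beurling_density r (graph_set nlogn) = 0"
    then have "Limsup at_top (\<lambda>h. SUP x. emeasure (count_space UNIV) (graph_set nlogn \<inter> ball x h) / ennreal (h powr r)) < 1"
      by (simp add: upper_beurling_density_def)
    then have ev: "eventually (\<lambda>h. (SUP x. emeasure (count_space UNIV) (graph_set nlogn \<inter> ball x h) / ennreal (h powr r)) < 1) at_top"
      by (rule Limsup_lessD)
    have "filterlim h at_top sequentially" unfolding h_def by real_asymp
    then have "eventually (\<lambda>N. (SUP x. emeasure (count_space UNIV) (graph_set nlogn \<inter> ball x (h N)) / ennreal (h N powr r)) < 1) sequentially"
      using ev by (rule eventually_compose_filterlim[rotated])
    moreover have "filterlim (\<lambda>N. real N / h N powr r) at_top sequentially"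
      unfolding h_def using r by real_asymp
    then have "eventually (\<lambda>N. real N / h N powr r \<ge> 1) sequentially"
      by (simp add: filterlim_at_top)
    ultimately have "eventually (\<lambda>N. False) sequentially"
    proof eventually_elim
      case (elim N)
      define A where "A = {n. vector [real_of_int n, nlogn n] \<in> ball (0::real^2) (h N)}"
      have "{1..int N} \<subseteq> A"
      proof
        fix n assume n: "n \<in> {1..int N}"
        have "norm (vector [real_of_int n, nlogn n] :: real^2) \<le> \<bar>real_of_int n\<bar> + \<bar>nlogn n\<bar>"
          unfolding norm_vector_2 by (rule sqrt_sum_squares_le_sum_abs)
        also have "\<dots> = real_of_int n * (1 + ln (1 + real_of_int n))"
          using n by (simp add: nlogn_def algebra_simps abs_mult)
        also have "\<dots> \<le> real N * (1 + ln (1 + real N))"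
          using n by (intro mult_mono) (auto simp: add_nonneg_nonneg)
        also have "\<dots> < h N" by (simp add: h_def algebra_simps add_pos_nonneg)
        finally show "n \<in> A" by (simp add: A_def)
      qed
      moreover have fin: "finite A" using count_nlogn_le(1)[of 1 "h N" 0] h_pos
        by (simp add: A_def finite_graph_set_Int_ball)
      ultimately have "card {1..int N} \<le> card A" by (intro card_mono)
      then have "real N \<le> real (card A)" by simp
      then have "1 \<le> real (card A) / h N powr r"
        using elim(2) h_pos[of N] by (intro order_trans[OF elim(2)] divide_right_mono) auto
      then have "1 \<le> ennreal (real (card A) / h N powr r)" by simp
      also have "\<dots> = emeasure (count_space UNIV) (graph_set nlogn \<inter> ball 0 (h N)) / ennreal (h N powr r)"
        using fin h_pos[of N] by (simp add: A_def finite_graph_set_Int_ball card_graph_set_Int_ball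
          ennreal_of_nat_eq_real_of_nat divide_ennreal)
      also have "\<dots> < 1"
        by (rule le_less_trans[OF _ elim(1)]) (rule SUP_upper, simp)
      finally show False by simp
    qed
    then show False by simp
  qed
qed

section \<open>Identification of the measure\<close>

text \<open>The interval is half-open so that \<open>t \<mapsto> exp (-2\<pi>it)\<close> is injective on it.\<close>

definition unit_uniform :: "real measure" where
  "unit_uniform = density lborel (indicator {0<..1})"

definition axis_embed :: "real \<Rightarrow> real^2" where
  "axis_embed t = vector [t, 0]"

definition segment_law :: "(real^2) measure" where
  "segment_law = distr unit_uniform borel axis_embed"

lemma sets_unit_uniform [simp, measurable_cong]: "sets unit_uniform = sets borel"
  by (simp add: unit_uniform_def)

lemma space_unit_uniform [simp]: "space unit_uniform = UNIV"
  by (simp add: unit_uniform_def)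

lemma sets_segment_law [simp, measurable_cong]: "sets segment_law = sets borel"
  by (simp add: segment_law_def)

lemma emeasure_unit_uniform:
  "A \<in> sets borel \<Longrightarrow> emeasure unit_uniform A = emeasure lborel ({0<..1} \<inter> A)"
  by (simp add: unit_uniform_def emeasure_density flip: indicator_inter_arith)

lemma prob_space_unit_uniform: "prob_space unit_uniform"
  by (rule prob_spaceI) (simp add: emeasure_unit_uniform)

lemma axis_embed_nth [simp]: "axis_embed t $ 1 = t" "axis_embed t $ 2 = 0"
  by (simp_all add: axis_embed_def)

lemma measurable_axis_embed [measurable]: "axis_embed \<in> borel_measurable borel"
proof -
  have "axis_embed = (\<lambda>t. t *\<^sub>R axis 1 1)"
    by (auto simp: fun_eq_iff vec_eq_iff forall_2 axis_def)
  also have "\<dots> \<in> borel_measurable borel" by measurable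
  finally show ?thesis .
qed

lemma prob_space_segment_law: "prob_space segment_law"
  unfolding segment_law_def by (rule prob_space.prob_space_distr[OF prob_space_unit_uniform]) simp

lemma measurable_vec_nth [measurable]: "(\<lambda>x::real^2. x $ i) \<in> borel_measurable borel"
  by (intro borel_measurable_continuous_onI continuous_intros)

section \<open>The contractions in coordinates\<close>

lemma matrix_inv_eqI:
  fixes A :: "real^'n^'n"
  assumes "A ** C = mat 1" "C ** A = mat 1"
  shows "matrix_inv A = C"
proof -
  have "A ** matrix_inv A = mat 1 \<and> matrix_inv A ** A = mat 1"
    unfolding matrix_inv_def by (rule someI[of _ C]) (use assms in auto)
  then have "C ** (A ** matrix_inv A) = C" by simp
  then show ?thesis using assms by (simp add: matrix_mul_assoc)
qed

text \<open>The contraction \<open>\<phi>\<^sub>b\<close> for \<open>b = (c, 0)\<close>, in coordinates.\<close>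

definition half_map :: "real \<Rightarrow> real^2 \<Rightarrow> real^2" where
  "half_map c x = vector [(x $ 1 + c) / 2 - x $ 2 / 4, x $ 2 / 2]"

lemma half_map_nth [simp]:
  "half_map c x $ 1 = (x $ 1 + c) / 2 - x $ 2 / 4" "half_map c x $ 2 = x $ 2 / 2"
  by (simp_all add: half_map_def)

lemma measurable_half_map [measurable]: "half_map c \<in> borel_measurable borel"
proof -
  have "half_map c = (\<lambda>x. ((x $ 1 + c) / 2 - x $ 2 / 4) *\<^sub>R axis 1 1 + (x $ 2 / 2) *\<^sub>R axis 2 1)"
    by (auto simp: fun_eq_iff vec_eq_iff forall_2 axis_def)
  also have "\<dots> \<in> borel_measurable borel" by measurable
  finally show ?thesis .
qed

lemma matrix_inv_R:
  "matrix_inv (vector [vector [2, 1], vector [0, 2]] :: real^2^2) *v (x + vector [c, 0]) = half_map c x"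
proof -
  have "matrix_inv (vector [vector [2, 1], vector [0, 2]] :: real^2^2) =
      vector [vector [1/2, -1/4], vector [0, 1/2]]"
    by (rule matrix_inv_eqI) (simp_all add: matrix_matrix_mult_def mat_def vec_eq_iff forall_2 sum_2)
  then show ?thesis
    by (simp only:) (simp add: vec_eq_iff forall_2 matrix_vector_mult_def sum_2 field_simps)
qed

lemma is_self_affine_measure_iff:
  "is_self_affine_measure (vector [vector [2, 1], vector [0, 2]]) {vector [0, 0], vector [1, 0]} \<mu> \<longleftrightarrow>
    prob_space \<mu> \<and> sets \<mu> = sets borel \<and>
    (\<forall>E\<in>sets borel. measure \<mu> E = measure \<mu> (half_map 0 -` E) / 2 + measure \<mu> (half_map 1 -` E) / 2)"
proof -
  \<comment> \<open>Distinctness of the two digits makes \<open>card B\<close> equal to 2 and the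
    sum run over two terms.\<close>
  have ne: "(vector [0, 0] :: real^2) \<noteq> vector [1, 0]" by (simp add: vec_eq_iff forall_2)
  show ?thesis
    unfolding is_self_affine_measure_def using ne by (simp add: matrix_inv_R)
qed

text \<open>The maps t -> t/2 and t -> (t+1)/2 carry the unit interval onto its two halves and scale
  length by 1/2, so the uniform law is the average of its two images.\<close>

lemma emeasure_unit_uniform_halves:
  assumes [measurable]: "A \<in> sets borel"
  shows "emeasure unit_uniform A =
    ennreal (1/2) * emeasure unit_uniform {t. t / 2 \<in> A} + ennreal (1/2) * emeasure unit_uniform {t. (t + 1) / 2 \<in> A}"
proof -
  have half: "emeasure lborel ({a<..a + 1/2} \<inter> A) = ennreal (1/2) * emeasure unit_uniform {t. a + t / 2 \<in> A}" for a :: real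
  proof -
    have "emeasure lborel ({a<..a + 1/2} \<inter> A) = (\<integral>\<^sup>+x. indicator ({a<..a + 1/2} \<inter> A) x \<partial>lborel)"
      by simp
    also have "\<dots> = ennreal \<bar>1/2\<bar> * (\<integral>\<^sup>+x. indicator ({a<..a + 1/2} \<inter> A) (a + 1/2 * x) \<partial>lborel)"
      by (rule nn_integral_real_affine) auto
    also have "(\<lambda>x. indicator ({a<..a + 1/2} \<inter> A) (a + 1/2 * x) :: ennreal) = indicator ({0<..1} \<inter> {t. a + t / 2 \<in> A})"
      by (auto simp: fun_eq_iff indicator_def)
    also have "(\<integral>\<^sup>+x. indicator ({0<..1} \<inter> {t. a + t / 2 \<in> A}) x \<partial>lborel) = emeasure unit_uniform {t. a + t / 2 \<in> A}"
      by (simp add: emeasure_unit_uniform)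
    finally show ?thesis by simp
  qed
  have "{0<..1} \<inter> A = ({0<..0 + 1/2} \<inter> A) \<union> ({1/2<..1/2 + 1/2} \<inter> A)" by auto
  then have "emeasure unit_uniform A = emeasure lborel (({0<..0 + 1/2} \<inter> A) \<union> ({1/2<..1/2 + 1/2} \<inter> A))"
    by (simp add: emeasure_unit_uniform)
  also have "\<dots> = emeasure lborel ({0<..0 + 1/2} \<inter> A) + emeasure lborel ({1/2<..1/2 + 1/2} \<inter> A)"
    by (rule plus_emeasure[symmetric]) auto
  also have "\<dots> = ennreal (1/2) * emeasure unit_uniform {t. 0 + t / 2 \<in> A}
      + ennreal (1/2) * emeasure unit_uniform {t. 1/2 + t / 2 \<in> A}"
    by (simp only: half)
  also have "{t. 1/2 + t / 2 \<in> A} = {t. (t + 1) / 2 \<in> A}" by (simp add: add_divide_distrib add.commute)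
  finally show ?thesis by simp
qed

text \<open>On the axis \<open>half_map c\<close> acts as t -> (t+c)/2, which reduces the claim to
  the halving identity for the uniform law.\<close>

lemma is_self_affine_measure_segment_law:
  "is_self_affine_measure (vector [vector [2, 1], vector [0, 2]]) {vector [0, 0], vector [1, 0]} segment_law"
  unfolding is_self_affine_measure_iff
proof (intro conjI ballI prob_space_segment_law sets_segment_law)
  fix E :: "(real^2) set" assume E [measurable]: "E \<in> sets borel"
  interpret prob_space unit_uniform by (rule prob_space_unit_uniform)
  have seg: "measure segment_law F = measure unit_uniform (axis_embed -` F)" if "F \<in> sets borel" for F
    unfolding segment_law_def using that by (subst measure_distr) auto
  have "half_map c (axis_embed t) = axis_embed ((t + c) / 2)" for c t
    by (simp add: vec_eq_iff forall_2)
  then have pre: "axis_embed -` half_map c -` E = {t. (t + c) / 2 \<in> axis_embed -` E}" for c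
    by auto
  have meas: "half_map c -` E \<in> sets borel" "axis_embed -` E \<in> sets borel" for c
    using measurable_sets[OF measurable_half_map E] measurable_sets[OF measurable_axis_embed E] by simp_all
  have "ennreal (measure unit_uniform (axis_embed -` E)) =
    ennreal (1/2) * ennreal (measure unit_uniform {t. (t + 0) / 2 \<in> axis_embed -` E})
      + ennreal (1/2) * ennreal (measure unit_uniform {t. (t + 1) / 2 \<in> axis_embed -` E})"
    using emeasure_unit_uniform_halves[OF meas(2)] by (simp only: emeasure_eq_measure add_0_right)
  also have "\<dots> = ennreal (1/2 * measure unit_uniform {t. (t + 0) / 2 \<in> axis_embed -` E}
      + 1/2 * measure unit_uniform {t. (t + 1) / 2 \<in> axis_embed -` E})"
    by (subst ennreal_plus) (simp_all only: ennreal_mult measure_nonneg, simp_all)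
  finally have "measure unit_uniform (axis_embed -` E) =
    1/2 * measure unit_uniform {t. (t + 0) / 2 \<in> axis_embed -` E}
      + 1/2 * measure unit_uniform {t. (t + 1) / 2 \<in> axis_embed -` E}"
    by (subst (asm) ennreal_inj) auto
  then show "measure segment_law E = measure segment_law (half_map 0 -` E) / 2 + measure segment_law (half_map 1 -` E) / 2"
    by (simp add: seg meas pre del: vimage_Collect_eq)
qed

section \<open>Uniqueness of the self-affine measure\<close>

text \<open>
  Outside \<open>[0, 1]\<close> iterating the equation pushes the argument to infinity; inside, it halves the
  distance to the identity at each step.
\<close>

lemma cdf_halving_unique:
  assumes N: "real_distribution N"
    and eq: "\<And>t. cdf N t = cdf N (2 * t) / 2 + cdf N (2 * t - 1) / 2"
  shows "cdf N t = max 0 (min 1 t)"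
proof -
  interpret real_distribution N by (rule N)
  have mono: "cdf N s \<le> cdf N t" if "s \<le> t" for s t using that by (rule cdf_nondecreasing)
  have le1: "cdf N t \<le> 1" for t by (rule cdf_bounded_prob)
  have ge0: "cdf N t \<ge> 0" for t by (rule cdf_nonneg)
  have neg: "cdf N t = 0" if "t < 0" for t
  proof -
    have "cdf N t \<le> cdf N (2 ^ n * t)" for n
    proof (induction n)
      case (Suc n)
      also have "cdf N (2 ^ n * t) \<le> cdf N (2 ^ Suc n * t)"
        using eq[of "2 ^ n * t"] mono[of "2 * (2 ^ n * t) - 1" "2 * (2 ^ n * t)"] by (simp add: mult.assoc)
      finally show ?case .
    qed simp
    moreover have "(\<lambda>n. cdf N (2 ^ n * t)) \<longlonglongrightarrow> 0"
    proof (rule filterlim_compose[OF cdf_lim_at_bot])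
      show "filterlim (\<lambda>n::nat. 2 ^ n * t) at_bot sequentially"
        using that by real_asymp
    qed
    ultimately have "cdf N t \<le> 0" by (intro LIMSEQ_le_const) auto
    then show ?thesis using ge0[of t] by simp
  qed
  have big: "cdf N t = 1" if "t > 1" for t
  proof -
    \<comment> \<open>The map t -> 2t - 1 fixes 1 and doubles the distance to it; by monotonicity
      its term is the smaller of the two averaged in \<open>eq\<close>.\<close>
    have "cdf N t \<ge> cdf N (1 + 2 ^ n * (t - 1))" for n
    proof (induction n)
      case (Suc n)
      have "cdf N (1 + 2 ^ n * (t - 1)) \<ge> cdf N (1 + 2 ^ Suc n * (t - 1))"
        using eq[of "1 + 2 ^ n * (t - 1)"]
          mono[of "2 * (1 + 2 ^ n * (t - 1)) - 1" "2 * (1 + 2 ^ n * (t - 1))"] by (simp add: algebra_simps)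
      then show ?case using Suc by linarith
    qed simp
    moreover have "(\<lambda>n. cdf N (1 + 2 ^ n * (t - 1))) \<longlonglongrightarrow> 1"
    proof (rule filterlim_compose[OF cdf_lim_at_top_prob])
      show "filterlim (\<lambda>n::nat. 1 + 2 ^ n * (t - 1)) at_top sequentially"
        using that by real_asymp
    qed
    ultimately have "cdf N t \<ge> 1" by (intro LIMSEQ_le_const2) auto
    then show ?thesis using le1[of t] by simp
  qed
  \<comment> \<open>Each endpoint is fixed by one of the two maps, so iteration cannot move it;
    there the unknown value stands on both sides of \<open>eq\<close>, which can be solved for
    it.\<close>
  have zero: "cdf N 0 = 0" using eq[of 0] neg[of "-1"] by simp
  have one: "cdf N 1 = 1" using eq[of 1] big[of 2] by simp
  have near: "\<bar>cdf N t - t\<bar> \<le> (1/2) ^ n" if "0 \<le> t" "t \<le> 1" for n t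
    using that
  proof (induction n arbitrary: t)
    case 0
    then show ?case using le1[of t] ge0[of t] by auto
  next
    case (Suc n)
    show ?case
    proof (cases "t \<le> 1/2")
      case True
      then have "cdf N (2 * t - 1) = 0"
        using neg[of "2 * t - 1"] zero by (cases "2 * t - 1 = 0") simp_all
      then show ?thesis using eq[of t] Suc.IH[of "2 * t"] Suc.prems True unfolding power_Suc by linarith
    next
      case False
      then have "cdf N (2 * t) = 1" using big by simp
      then show ?thesis using eq[of t] Suc.IH[of "2 * t - 1"] Suc.prems False unfolding power_Suc by linarith
    qed
  qed
  have "cdf N t = t" if "0 \<le> t" "t \<le> 1"
  proof -
    have "(\<lambda>n. (1/2 :: real) ^ n) \<longlonglongrightarrow> 0" by (intro LIMSEQ_realpow_zero) auto
    then have "\<bar>cdf N t - t\<bar> \<le> 0" using near[OF that] by (intro LIMSEQ_le_const) auto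
    then show ?thesis by simp
  qed
  then show ?thesis using neg big by (cases "t < 0"; cases "t > 1") auto
qed

text \<open>Both contractions halve the modulus of the second coordinate, so the events
  \<open>\<bar>x $ 2\<bar> \<le> c\<close> and \<open>\<bar>x $ 2\<bar> \<le> 2 * c\<close> have
  equal probability. Repeated doubling drives that probability to 1 for every positive c.\<close>

lemma self_affine_measure_on_axis:
  assumes "is_self_affine_measure (vector [vector [2, 1], vector [0, 2]]) {vector [0, 0], vector [1, 0]} \<mu>"
  shows "AE x in \<mu>. x $ 2 = 0"
proof -
  have "prob_space \<mu>" and sets [simp, measurable_cong]: "sets \<mu> = sets borel"
    and inv: "\<And>E. E \<in> sets borel \<Longrightarrow> measure \<mu> E = measure \<mu> (half_map 0 -` E) / 2 + measure \<mu> (half_map 1 -` E) / 2"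
    using assms by (auto simp: is_self_affine_measure_iff)
  interpret prob_space \<mu> by fact
  have [simp]: "space \<mu> = UNIV" using sets_eq_imp_space_eq[OF sets] by simp
  define N where "N = distr \<mu> borel (\<lambda>x. \<bar>x $ 2\<bar>)"
  interpret N: real_distribution N
    unfolding N_def by (intro real_distribution.intro prob_space_distr real_distribution_axioms.intro) auto
  have cdf_N: "cdf N c = measure \<mu> {x. \<bar>x $ 2\<bar> \<le> c}" for c
    unfolding cdf_def N_def by (subst measure_distr) (auto simp: vimage_def)
  have double: "cdf N c = cdf N (2 * c)" for c
  proof -
    have "half_map d -` {x. \<bar>x $ 2\<bar> \<le> c} = {x. \<bar>x $ 2\<bar> \<le> 2 * c}" for d by auto
    moreover have "{x :: real^2. \<bar>x $ 2\<bar> \<le> c} \<in> sets borel" by measurable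
    ultimately show ?thesis unfolding cdf_N by (subst inv) auto
  qed
  have "AE x in \<mu>. \<bar>x $ 2\<bar> \<le> c" if "c > 0" for c
  proof -
    have "cdf N c = cdf N (2 ^ n * c)" for n
    proof (induction n)
      case (Suc n)
      then show ?case using double[of "2 ^ n * c"] by (simp add: mult.assoc)
    qed simp
    moreover have "(\<lambda>n. cdf N (2 ^ n * c)) \<longlonglongrightarrow> 1"
    proof (rule filterlim_compose[OF N.cdf_lim_at_top_prob])
      show "filterlim (\<lambda>n::nat. 2 ^ n * c) at_top sequentially"
        using that by real_asymp
    qed
    ultimately have "(\<lambda>n::nat. cdf N c) \<longlonglongrightarrow> 1" by simp
    then have "measure \<mu> {x. \<bar>x $ 2\<bar> \<le> c} = 1" by (simp add: LIMSEQ_const_iff cdf_N)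
    then show ?thesis using AE_prob_1[of "{x. \<bar>x $ 2\<bar> \<le> c}"] by simp
  qed
  then have "AE x in \<mu>. \<forall>n. \<bar>x $ 2\<bar> \<le> 1 / real (Suc n)"
    unfolding AE_all_countable by simp
  then show ?thesis
  proof eventually_elim
    case (elim x)
    have "(\<lambda>n. 1 / real (Suc n)) \<longlonglongrightarrow> 0"
      using LIMSEQ_inverse_real_of_nat by (simp add: inverse_eq_divide)
    then have "\<bar>x $ 2\<bar> \<le> 0" using elim by (intro LIMSEQ_le_const) auto
    then show ?case by simp
  qed
qed

lemma cdf_self_affine_measure_fst:
  assumes "is_self_affine_measure (vector [vector [2, 1], vector [0, 2]]) {vector [0, 0], vector [1, 0]} \<mu>"
  shows "real_distribution (distr \<mu> borel (\<lambda>x. x $ 1))"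
    "cdf (distr \<mu> borel (\<lambda>x. x $ 1)) t = max 0 (min 1 t)"
proof -
  have "prob_space \<mu>" and sets [simp, measurable_cong]: "sets \<mu> = sets borel"
    and inv: "\<And>E. E \<in> sets borel \<Longrightarrow> measure \<mu> E = measure \<mu> (half_map 0 -` E) / 2 + measure \<mu> (half_map 1 -` E) / 2"
    using assms by (auto simp: is_self_affine_measure_iff)
  interpret prob_space \<mu> by fact
  have [simp]: "space \<mu> = UNIV" using sets_eq_imp_space_eq[OF sets] by simp
  show N: "real_distribution (distr \<mu> borel (\<lambda>x. x $ 1))"
    by (intro real_distribution.intro prob_space_distr real_distribution_axioms.intro) auto
  have cdf_N: "cdf (distr \<mu> borel (\<lambda>x. x $ 1)) c = measure \<mu> {x. x $ 1 \<le> c}" for c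
    unfolding cdf_def by (subst measure_distr) (auto simp: vimage_def)
  \<comment> \<open>The preimage is a half-plane whose boundary is tilted by the shear; off the null
    set where the second coordinate is nonzero it agrees with a vertical one.\<close>
  have pre: "measure \<mu> (half_map d -` {x. x $ 1 \<le> s}) = measure \<mu> {x. x $ 1 \<le> 2 * s - d}" for d s
  proof (rule measure_eq_AE)
    show "AE x in \<mu>. x \<in> half_map d -` {x. x $ 1 \<le> s} \<longleftrightarrow> x \<in> {x. x $ 1 \<le> 2 * s - d}"
      using self_affine_measure_on_axis[OF assms] by eventually_elim auto
    show "half_map d -` {x. x $ 1 \<le> s} \<in> sets \<mu>"
      unfolding vimage_def by simp
  qed simp
  show "cdf (distr \<mu> borel (\<lambda>x. x $ 1)) t = max 0 (min 1 t)"
  proof (rule cdf_halving_unique[OF N])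
    fix s
    have "measure \<mu> {x. x $ 1 \<le> s} = measure \<mu> {x. x $ 1 \<le> 2 * s} / 2 + measure \<mu> {x. x $ 1 \<le> 2 * s - 1} / 2"
      using inv[of "{x. x $ 1 \<le> s}"] unfolding pre by simp
    then show "cdf (distr \<mu> borel (\<lambda>x. x $ 1)) s =
        cdf (distr \<mu> borel (\<lambda>x. x $ 1)) (2 * s) / 2 + cdf (distr \<mu> borel (\<lambda>x. x $ 1)) (2 * s - 1) / 2"
      unfolding cdf_N .
  qed
qed

lemma self_affine_measure_eq_distr:
  assumes "is_self_affine_measure (vector [vector [2, 1], vector [0, 2]]) {vector [0, 0], vector [1, 0]} \<mu>"
  shows "\<mu> = distr (distr \<mu> borel (\<lambda>x. x $ 1)) borel axis_embed"
proof -
  have sets [simp, measurable_cong]: "sets \<mu> = sets borel"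
    using assms by (auto simp: is_self_affine_measure_iff)
  have "distr (distr \<mu> borel (\<lambda>x. x $ 1)) borel axis_embed = distr \<mu> borel (\<lambda>x. axis_embed (x $ 1))"
    by (subst distr_distr) (auto simp: o_def)
  also have "\<dots> = distr \<mu> borel (\<lambda>x. x)"
  proof (rule distr_cong_AE)
    show "AE x in \<mu>. axis_embed (x $ 1) = x"
      using self_affine_measure_on_axis[OF assms] by eventually_elim (simp add: vec_eq_iff forall_2)
  qed auto
  also have "\<dots> = \<mu>" by (rule distr_id2) simp
  finally show ?thesis by simp
qed

lemma self_affine_measure_eq_segment_law:
  "self_affine_measure (vector [vector [2, 1], vector [0, 2]]) {vector [0, 0], vector [1, 0]} = segment_law"
  unfolding self_affine_measure_def
proof (rule the_equality)
  note seg = is_self_affine_measure_segment_law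
  show "is_self_affine_measure (vector [vector [2, 1], vector [0, 2]]) {vector [0, 0], vector [1, 0]} segment_law"
    by (rule seg)
  fix \<mu> :: "(real^2) measure"
  assume mu: "is_self_affine_measure (vector [vector [2, 1], vector [0, 2]]) {vector [0, 0], vector [1, 0]} \<mu>"
  \<comment> \<open>\<open>segment_law\<close> is itself a solution, so the same lemma gives its
    first marginal the same distribution function, with no separate computation for the uniform
    law.\<close>
  have "distr \<mu> borel (\<lambda>x. x $ 1) = distr segment_law borel (\<lambda>x. x $ 1)"
    by (rule cdf_unique) (auto simp: cdf_self_affine_measure_fst[OF mu] cdf_self_affine_measure_fst[OF seg])
  then show "\<mu> = segment_law"
    using self_affine_measure_eq_distr[OF mu] self_affine_measure_eq_distr[OF seg] by simp
qed

section \<open>Approximation in the mean square\<close>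

text \<open>A substitute for the triangle inequality that works with squared norms throughout; the
  factor 2 is absorbed by choosing errors of a quarter of the target.\<close>

lemma cmod_add_squared_le: "(cmod (a + b))\<^sup>2 \<le> 2 * (cmod a)\<^sup>2 + 2 * (cmod b)\<^sup>2"
proof -
  have "(cmod (a + b))\<^sup>2 \<le> (cmod a + cmod b)\<^sup>2"
    by (intro power_mono norm_triangle_ineq) auto
  also have "\<dots> \<le> 2 * (cmod a)\<^sup>2 + 2 * (cmod b)\<^sup>2"
    using sum_squares_bound[of "cmod a" "cmod b"] by (simp add: power2_sum)
  finally show ?thesis .
qed

lemma in_L2_add:
  assumes "in_L2 M f" "in_L2 M g"
  shows "in_L2 M (\<lambda>x. f x + g x)"
proof -
  have [measurable]: "f \<in> borel_measurable M" "g \<in> borel_measurable M"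
    and "integrable M (\<lambda>x. 2 * (cmod (f x))\<^sup>2 + 2 * (cmod (g x))\<^sup>2)"
    using assms by (auto simp: in_L2_def)
  then show ?thesis unfolding in_L2_def
    by (auto intro!: Bochner_Integration.integrable_bound[where g = "\<lambda>x. (cmod (f x + g x))\<^sup>2"] cmod_add_squared_le)
qed

lemma in_L2_scale: "in_L2 M f \<Longrightarrow> in_L2 M (\<lambda>x. c * f x)"
  by (auto simp: in_L2_def norm_mult power_mult_distrib)

lemma in_L2_diff:
  assumes "in_L2 M f" "in_L2 M g"
  shows "in_L2 M (\<lambda>x. f x - g x)"
  using in_L2_add[OF assms(1) in_L2_scale[OF assms(2), of "-1"]] by simp

lemma (in finite_measure) in_L2_bounded:
  assumes "f \<in> borel_measurable M" "\<And>x. x \<in> space M \<Longrightarrow> cmod (f x) \<le> C"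
  shows "in_L2 M f"
  unfolding in_L2_def using assms
  by (auto intro!: integrable_const_bound[where B = "C\<^sup>2"] power_mono AE_I2)

lemma integral_add_squared_le:
  assumes "in_L2 M f" "in_L2 M g"
  shows "(\<integral>x. (cmod (f x + g x))\<^sup>2 \<partial>M) \<le> 2 * (\<integral>x. (cmod (f x))\<^sup>2 \<partial>M) + 2 * (\<integral>x. (cmod (g x))\<^sup>2 \<partial>M)"
proof -
  have "(\<integral>x. (cmod (f x + g x))\<^sup>2 \<partial>M) \<le> (\<integral>x. 2 * (cmod (f x))\<^sup>2 + 2 * (cmod (g x))\<^sup>2 \<partial>M)"
    using assms in_L2_add[OF assms]
    by (intro integral_mono cmod_add_squared_le) (auto simp: in_L2_def)
  also have "\<dots> = 2 * (\<integral>x. (cmod (f x))\<^sup>2 \<partial>M) + 2 * (\<integral>x. (cmod (g x))\<^sup>2 \<partial>M)"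
    using assms by (subst Bochner_Integration.integral_add) (auto simp: in_L2_def)
  finally show ?thesis .
qed

text \<open>Errors are measured by the squared norm, which avoids Minkowski's inequality. Membership
  of the approximant in L2 is part of the condition, because a nonintegrable error would have
  Bochner integral 0 and count as small.\<close>

definition L2_closure :: "'a measure \<Rightarrow> ('a \<Rightarrow> complex) set \<Rightarrow> ('a \<Rightarrow> complex) set" where
  "L2_closure M P = {f. in_L2 M f \<and>
     (\<forall>\<epsilon>>0. \<exists>p\<in>P. in_L2 M p \<and> (\<integral>x. (cmod (f x - p x))\<^sup>2 \<partial>M) < \<epsilon>)}"

lemma L2_closureE:
  assumes "f \<in> L2_closure M P" "\<epsilon> > 0"
  obtains p where "p \<in> P" "in_L2 M p" "(\<integral>x. (cmod (f x - p x))\<^sup>2 \<partial>M) < \<epsilon>"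
  using assms unfolding L2_closure_def by blast

lemma L2_closure_in_L2: "f \<in> L2_closure M P \<Longrightarrow> in_L2 M f"
  by (simp add: L2_closure_def)

lemma L2_closure_base:
  assumes "p \<in> P" "in_L2 M p"
  shows "p \<in> L2_closure M P"
  unfolding L2_closure_def
proof (intro CollectI conjI assms(2) allI impI)
  show "\<exists>q\<in>P. in_L2 M q \<and> (\<integral>x. (cmod (p x - q x))\<^sup>2 \<partial>M) < \<epsilon>" if "\<epsilon> > 0" for \<epsilon> :: real
    using assms that by (intro bexI[of _ p]) simp_all
qed

lemma L2_closure_limit:
  assumes f: "in_L2 M f"
    and ex: "\<And>\<epsilon>. \<epsilon> > 0 \<Longrightarrow> \<exists>g\<in>L2_closure M P. (\<integral>x. (cmod (f x - g x))\<^sup>2 \<partial>M) < \<epsilon>"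
  shows "f \<in> L2_closure M P"
  unfolding L2_closure_def
proof (intro CollectI conjI f allI impI)
  fix \<epsilon> :: real assume "\<epsilon> > 0"
  then obtain g where g: "g \<in> L2_closure M P" "(\<integral>x. (cmod (f x - g x))\<^sup>2 \<partial>M) < \<epsilon> / 4"
    using ex[of "\<epsilon> / 4"] by auto
  obtain p where p: "p \<in> P" "in_L2 M p" "(\<integral>x. (cmod (g x - p x))\<^sup>2 \<partial>M) < \<epsilon> / 4"
    using L2_closureE[OF g(1), of "\<epsilon> / 4"] \<open>\<epsilon> > 0\<close> by auto
  have "in_L2 M g" using g(1) by (rule L2_closure_in_L2)
  then have "(\<integral>x. (cmod ((f x - g x) + (g x - p x)))\<^sup>2 \<partial>M) < \<epsilon>"
    using integral_add_squared_le[OF in_L2_diff[OF f \<open>in_L2 M g\<close>] in_L2_diff[OF \<open>in_L2 M g\<close> p(2)]]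
      g(2) p(3) by linarith
  then show "\<exists>p\<in>P. in_L2 M p \<and> (\<integral>x. (cmod (f x - p x))\<^sup>2 \<partial>M) < \<epsilon>"
    using p by auto
qed

lemma L2_closure_seq_limit:
  assumes "in_L2 M f" "\<And>k. g k \<in> L2_closure M P"
    and "(\<lambda>k. \<integral>x. (cmod (f x - g k x))\<^sup>2 \<partial>M) \<longlonglongrightarrow> 0"
  shows "f \<in> L2_closure M P"
proof (rule L2_closure_limit[OF assms(1)])
  fix \<epsilon> :: real assume "\<epsilon> > 0"
  then have "eventually (\<lambda>k. (\<integral>x. (cmod (f x - g k x))\<^sup>2 \<partial>M) < \<epsilon>) sequentially"
    using assms(3) by (intro order_tendstoD) auto
  then show "\<exists>g\<in>L2_closure M P. (\<integral>x. (cmod (f x - g x))\<^sup>2 \<partial>M) < \<epsilon>"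
    using assms(2) by (auto simp: eventually_sequentially)
qed

text \<open>The limit inherits the bound \<open>w\<close>, so the squared errors are dominated by
  (2w)^2 and dominated convergence gives convergence in mean square.\<close>

lemma L2_closure_dominated_limit:
  assumes f: "f \<in> borel_measurable M" and g: "\<And>k. g k \<in> L2_closure M P"
    and w: "integrable M (\<lambda>x. (w x)\<^sup>2)"
    and lim: "\<And>x. x \<in> space M \<Longrightarrow> (\<lambda>k. g k x) \<longlonglongrightarrow> f x"
    and bd: "\<And>k x. x \<in> space M \<Longrightarrow> cmod (g k x) \<le> w x"
  shows "f \<in> L2_closure M P"
proof -
  have [measurable]: "f \<in> borel_measurable M" "g k \<in> borel_measurable M" for k
    using f L2_closure_in_L2[OF g] by (simp_all add: in_L2_def)
  have fw: "cmod (f x) \<le> w x" if "x \<in> space M" for x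
    using lim[OF that] bd[OF that] by (intro Lim_bounded[OF tendsto_norm]) auto
  have f2: "in_L2 M f"
    unfolding in_L2_def using fw
    by (auto intro!: Bochner_Integration.integrable_bound[OF w] AE_I2 power_mono)
  have "(\<lambda>k. \<integral>x. (cmod (f x - g k x))\<^sup>2 \<partial>M) \<longlonglongrightarrow> (\<integral>x. 0 \<partial>M)"
  proof (rule integral_dominated_convergence[where w = "\<lambda>x. 4 * (w x)\<^sup>2"])
    show "AE x in M. (\<lambda>k. (cmod (f x - g k x))\<^sup>2) \<longlonglongrightarrow> 0"
    proof (rule AE_I2)
      fix x assume "x \<in> space M"
      then have "(\<lambda>k. (cmod (f x - g k x))\<^sup>2) \<longlonglongrightarrow> (cmod (f x - f x))\<^sup>2"
        using lim by (intro tendsto_intros)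
      then show "(\<lambda>k. (cmod (f x - g k x))\<^sup>2) \<longlonglongrightarrow> 0" by simp
    qed
    show "AE x in M. norm ((cmod (f x - g k x))\<^sup>2) \<le> 4 * (w x)\<^sup>2" for k
    proof (rule AE_I2)
      fix x assume x: "x \<in> space M"
      have "cmod (f x - g k x) \<le> 2 * w x"
        using norm_triangle_ineq4[of "f x" "g k x"] fw[OF x] bd[OF x, of k] by simp
      then have "(cmod (f x - g k x))\<^sup>2 \<le> (2 * w x)\<^sup>2" by (intro power_mono) auto
      then show "norm ((cmod (f x - g k x))\<^sup>2) \<le> 4 * (w x)\<^sup>2" by (simp add: power_mult_distrib)
    qed
  qed (use w in auto)
  then show ?thesis using f2 g by (intro L2_closure_seq_limit[of M f g]) auto
qed

lemma L2_closure_add: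
  assumes P: "\<And>p q. p \<in> P \<Longrightarrow> q \<in> P \<Longrightarrow> (\<lambda>x. p x + q x) \<in> P"
    and fg: "f \<in> L2_closure M P" "g \<in> L2_closure M P"
  shows "(\<lambda>x. f x + g x) \<in> L2_closure M P"
  unfolding L2_closure_def
proof (intro CollectI conjI allI impI)
  have L2: "in_L2 M f" "in_L2 M g" using fg by (auto simp: L2_closure_def)
  then show "in_L2 M (\<lambda>x. f x + g x)" by (rule in_L2_add)
  fix \<epsilon> :: real assume "\<epsilon> > 0"
  then have "\<epsilon> / 4 > 0" by simp
  obtain p where p: "p \<in> P" "in_L2 M p" "(\<integral>x. (cmod (f x - p x))\<^sup>2 \<partial>M) < \<epsilon> / 4"
    using L2_closureE[OF fg(1) \<open>\<epsilon> / 4 > 0\<close>] by blast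
  obtain q where q: "q \<in> P" "in_L2 M q" "(\<integral>x. (cmod (g x - q x))\<^sup>2 \<partial>M) < \<epsilon> / 4"
    using L2_closureE[OF fg(2) \<open>\<epsilon> / 4 > 0\<close>] by blast
  have "(\<integral>x. (cmod ((f x - p x) + (g x - q x)))\<^sup>2 \<partial>M) < \<epsilon>"
    using integral_add_squared_le[OF in_L2_diff[OF L2(1) p(2)] in_L2_diff[OF L2(2) q(2)]] p(3) q(3)
    by linarith
  then show "\<exists>p\<in>P. in_L2 M p \<and> (\<integral>x. (cmod (f x + g x - p x))\<^sup>2 \<partial>M) < \<epsilon>"
    using p q P by (intro bexI[of _ "\<lambda>x. p x + q x"]) (simp_all add: in_L2_add algebra_simps)
qed

lemma L2_closure_scale:
  assumes P: "\<And>p c. p \<in> P \<Longrightarrow> (\<lambda>x. c * p x) \<in> P"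
    and f: "f \<in> L2_closure M P"
  shows "(\<lambda>x. c * f x) \<in> L2_closure M P"
  unfolding L2_closure_def
proof (intro CollectI conjI allI impI)
  have L2: "in_L2 M f" using f by (auto simp: L2_closure_def)
  then show "in_L2 M (\<lambda>x. c * f x)" by (rule in_L2_scale)
  fix \<epsilon> :: real assume "\<epsilon> > 0"
  \<comment> \<open>The \<open>+ 1\<close> keeps the denominator positive for \<open>c = 0\<close>
    and makes the estimate strict.\<close>
  define \<delta> where "\<delta> = \<epsilon> / ((cmod c)\<^sup>2 + 1)"
  have pos: "(cmod c)\<^sup>2 + 1 > 0" by (simp add: add_nonneg_pos)
  then have "\<delta> > 0" using \<open>\<epsilon> > 0\<close> by (simp add: \<delta>_def)
  then obtain p where p: "p \<in> P" "in_L2 M p" "(\<integral>x. (cmod (f x - p x))\<^sup>2 \<partial>M) < \<delta>"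
    using L2_closureE[OF f, of \<delta>] by blast
  have "(\<integral>x. (cmod (c * f x - c * p x))\<^sup>2 \<partial>M) = (cmod c)\<^sup>2 * (\<integral>x. (cmod (f x - p x))\<^sup>2 \<partial>M)"
    by (simp add: norm_mult power_mult_distrib flip: right_diff_distrib)
  also have "\<dots> \<le> (cmod c)\<^sup>2 * \<delta>" using p by (intro mult_left_mono) auto
  also have "\<dots> < ((cmod c)\<^sup>2 + 1) * \<delta>" using \<open>\<delta> > 0\<close> by (simp add: algebra_simps)
  also have "\<dots> = \<epsilon>" using pos by (simp add: \<delta>_def)
  finally show "\<exists>p\<in>P. in_L2 M p \<and> (\<integral>x. (cmod (c * f x - p x))\<^sup>2 \<partial>M) < \<epsilon>"
    using p P by (intro bexI[of _ "\<lambda>x. c * p x"]) (simp_all add: in_L2_scale)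
qed

lemma L2_closure_sum:
  assumes add: "\<And>p q. p \<in> P \<Longrightarrow> q \<in> P \<Longrightarrow> (\<lambda>x. p x + q x) \<in> P"
    and zero: "(\<lambda>_. 0) \<in> P"
    and "finite I" "\<And>i. i \<in> I \<Longrightarrow> f i \<in> L2_closure M P"
  shows "(\<lambda>x. \<Sum>i\<in>I. f i x) \<in> L2_closure M P"
  using assms(3,4)
proof (induction I)
  case empty
  show ?case using L2_closure_base[OF zero] by (simp add: in_L2_def)
next
  case (insert i I)
  have "(\<lambda>x. f i x + (\<Sum>i\<in>I. f i x)) \<in> L2_closure M P"
    by (rule L2_closure_add) (use insert add in simp_all)
  then show ?case using insert by simp
qed

text \<open>Indicators span the simple functions, and f is a pointwise limit of simple functions
  bounded by 2|f|, which is square integrable.\<close>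

lemma L2_closure_eq_if_indicators:
  assumes add: "\<And>p q. p \<in> P \<Longrightarrow> q \<in> P \<Longrightarrow> (\<lambda>x. p x + q x) \<in> P"
    and scale: "\<And>p c. p \<in> P \<Longrightarrow> (\<lambda>x. c * p x) \<in> P"
    and ind: "\<And>E. E \<in> sets M \<Longrightarrow> (\<lambda>x. of_real (indicator E x)) \<in> L2_closure M P"
    and f: "in_L2 M f"
  shows "f \<in> L2_closure M P"
proof -
  have [measurable]: "f \<in> borel_measurable M" using f by (simp add: in_L2_def)
  obtain F where F: "\<And>i. simple_function M (F i)"
    "\<And>x. x \<in> space M \<Longrightarrow> (\<lambda>i. F i x) \<longlonglongrightarrow> f x"
    "\<And>i x. x \<in> space M \<Longrightarrow> dist (F i x) 0 \<le> 2 * dist (f x) 0"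
    using borel_measurable_implies_sequence_metric[OF \<open>f \<in> borel_measurable M\<close>, of 0] by blast
  \<comment> \<open>The indicator of the empty set already has an approximant in \<open>P\<close>;
    multiplying that by 0 yields the zero function.\<close>
  have "P \<noteq> {}" using ind[OF sets.empty_sets] zero_less_one unfolding L2_closure_def by blast
  then have zero: "(\<lambda>_. 0) \<in> P" using scale[of _ 0] by auto
  have simple: "h \<in> L2_closure M P" if h: "simple_function M h" for h
  proof -
    define h' where "h' x = (\<Sum>y\<in>h ` space M. y * of_real (indicator (h -` {y} \<inter> space M) x))" for x
    have h': "h' \<in> L2_closure M P"
      unfolding h'_def using h by (intro L2_closure_sum add zero L2_closure_scale scale ind) (auto simp: simple_function_def)
    have eq: "h' x = h x" if x: "x \<in> space M" for x
    proof -
      have "h' x = (\<Sum>y\<in>h ` space M. if h x = y then y else 0)"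
        unfolding h'_def using x by (intro sum.cong) (auto simp: indicator_def)
      also have "\<dots> = h x" using h x by (simp add: simple_function_def)
      finally show ?thesis .
    qed
    \<comment> \<open>\<open>h'\<close> agrees with \<open>h\<close> only on the space of
      \<open>M\<close>; a constant sequence in the dominated limit passes from one to the
      other.\<close>
    have "integrable M (\<lambda>x. (cmod (h' x))\<^sup>2)" using h' by (simp add: L2_closure_def in_L2_def)
    then show ?thesis
    proof (rule L2_closure_dominated_limit[where g = "\<lambda>_. h'", rotated 2])
      show "h \<in> borel_measurable M" using h by (rule borel_measurable_simple_function)
    qed (use h' eq in \<open>auto intro: tendsto_eq_intros\<close>)
  qed
  have "integrable M (\<lambda>x. (2 * cmod (f x))\<^sup>2)"
    using f by (simp add: in_L2_def power_mult_distrib)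
  then show ?thesis
  proof (rule L2_closure_dominated_limit[where g = F, rotated 2])
    show "F k \<in> L2_closure M P" for k by (rule simple[OF F(1)])
    show "cmod (F k x) \<le> 2 * cmod (f x)" if "x \<in> space M" for k x using F(3)[OF that, of k] by simp
  qed (use F(2) in auto)
qed

section \<open>Density of trigonometric polynomials\<close>

text \<open>The trace of \<open>exponential\<close> on the axis for a frequency with first
  coordinate \<open>n\<close>, hence the minus sign.\<close>

definition fourier_char :: "int \<Rightarrow> real \<Rightarrow> complex" where
  "fourier_char n t = cis (- (2 * pi * (real_of_int n * t)))"

definition trig_polys :: "(real \<Rightarrow> complex) set" where
  "trig_polys = {\<lambda>t. \<Sum>n\<in>F. c n * fourier_char n t |F c. finite F}"

lemma trig_polysI:
  assumes "finite F" "\<And>t. p t = (\<Sum>n\<in>F. c n * fourier_char n t)"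
  shows "p \<in> trig_polys"
  unfolding trig_polys_def using assms by (intro CollectI exI[of _ F] exI[of _ c]) auto

lemma measurable_unit_uniform: "borel_measurable unit_uniform = borel_measurable borel"
  by (rule measurable_cong_sets) simp_all

lemma measurable_cnj [measurable]: "(\<lambda>z. cnj z) \<in> borel_measurable borel"
  by (intro borel_measurable_continuous_onI continuous_intros)

lemma fourier_char_add: "fourier_char (m + n) t = fourier_char m t * fourier_char n t"
  by (simp add: fourier_char_def cis_mult algebra_simps)

lemma measurable_fourier_char [measurable]: "fourier_char n \<in> borel_measurable borel"
  unfolding fourier_char_def by (intro borel_measurable_continuous_onI continuous_intros)

lemma trig_polys_add:
  assumes "p \<in> trig_polys" "q \<in> trig_polys"
  shows "(\<lambda>t. p t + q t) \<in> trig_polys"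
proof -
  obtain F c where F: "finite F" "p = (\<lambda>t. \<Sum>n\<in>F. c n * fourier_char n t)"
    using assms(1) by (auto simp: trig_polys_def)
  obtain G d where G: "finite G" "q = (\<lambda>t. \<Sum>n\<in>G. d n * fourier_char n t)"
    using assms(2) by (auto simp: trig_polys_def)
  define e where "e n = (if n \<in> F then c n else 0) + (if n \<in> G then d n else 0)" for n
  have "p t = (\<Sum>n\<in>F \<union> G. (if n \<in> F then c n else 0) * fourier_char n t)" for t
    unfolding F(2) using F(1) G(1) by (intro sum.mono_neutral_cong_left) auto
  moreover have "q t = (\<Sum>n\<in>F \<union> G. (if n \<in> G then d n else 0) * fourier_char n t)" for t
    unfolding G(2) using F(1) G(1) by (intro sum.mono_neutral_cong_left) auto
  ultimately have "p t + q t = (\<Sum>n\<in>F \<union> G. e n * fourier_char n t)" for t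
    by (simp add: e_def distrib_right sum.distrib)
  then show ?thesis using F(1) G(1) by (intro trig_polysI) auto
qed

lemma trig_polys_scale:
  assumes "p \<in> trig_polys"
  shows "(\<lambda>t. a * p t) \<in> trig_polys"
proof -
  obtain F c where F: "finite F" "p = (\<lambda>t. \<Sum>n\<in>F. c n * fourier_char n t)"
    using assms(1) by (auto simp: trig_polys_def)
  have "a * p t = (\<Sum>n\<in>F. (a * c n) * fourier_char n t)" for t
    unfolding F(2) by (simp add: sum_distrib_left mult.assoc)
  then show ?thesis by (rule trig_polysI[OF F(1)])
qed

lemma trig_polys_char: "fourier_char n \<in> trig_polys"
  by (rule trig_polysI[of "{n}" _ "\<lambda>_. 1"]) simp_all

lemma trig_polys_const: "(\<lambda>_. a) \<in> trig_polys"
  using trig_polys_scale[OF trig_polys_char[of 0], of a] by (simp add: fourier_char_def)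

lemma trig_polys_sum:
  assumes "finite I" "\<And>i. i \<in> I \<Longrightarrow> p i \<in> trig_polys"
  shows "(\<lambda>t. \<Sum>i\<in>I. p i t) \<in> trig_polys"
  using assms
proof (induction I)
  case empty
  show ?case using trig_polys_const[of 0] by simp
next
  case (insert i I)
  then show ?case using trig_polys_add[of "p i" "\<lambda>t. \<Sum>i\<in>I. p i t"] by simp
qed

lemma trig_polys_mult:
  assumes "p \<in> trig_polys" "q \<in> trig_polys"
  shows "(\<lambda>t. p t * q t) \<in> trig_polys"
proof -
  obtain F c where F: "finite F" "p = (\<lambda>t. \<Sum>n\<in>F. c n * fourier_char n t)"
    using assms(1) by (auto simp: trig_polys_def)
  obtain G d where G: "finite G" "q = (\<lambda>t. \<Sum>n\<in>G. d n * fourier_char n t)"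
    using assms(2) by (auto simp: trig_polys_def)
  have "(\<lambda>t. p t * q t) = (\<lambda>t. \<Sum>m\<in>F. \<Sum>n\<in>G. (c m * d n) * fourier_char (m + n) t)"
    by (auto simp: F(2) G(2) sum_product fourier_char_add mult_ac intro!: ext sum.cong)
  also have "\<dots> \<in> trig_polys"
    using F(1) G(1) by (intro trig_polys_sum trig_polys_scale trig_polys_char)
  finally show ?thesis .
qed

lemma in_L2_trig_poly:
  assumes "p \<in> trig_polys"
  shows "in_L2 unit_uniform p"
proof -
  interpret prob_space unit_uniform by (rule prob_space_unit_uniform)
  obtain F c where F: "finite F" "p = (\<lambda>t. \<Sum>n\<in>F. c n * fourier_char n t)"
    using assms(1) by (auto simp: trig_polys_def)
  have "cmod (p t) \<le> (\<Sum>n\<in>F. cmod (c n))" for t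
    unfolding F(2) by (rule order_trans[OF norm_sum]) (simp add: norm_mult fourier_char_def)
  moreover have "p \<in> borel_measurable unit_uniform" unfolding F(2) by measurable
  ultimately show ?thesis by (intro in_L2_bounded) auto
qed

text \<open>Polynomials on the plane are built from real linear functionals, that is, combinations
  of z and its conjugate; on the circle conjugation turns the character 1 into the character
  -1.\<close>

lemma real_polynomial_function_trig_poly:
  assumes "real_polynomial_function g"
  shows "(\<lambda>t. of_real (g (fourier_char 1 t))) \<in> trig_polys"
  using assms
proof (induction g)
  case (linear g)
  have cnj: "cnj (fourier_char 1 t) = fourier_char (-1) t" for t
    by (simp add: fourier_char_def cis_cnj)
  have Re: "complex_of_real (Re z) = (1/2) * z + (1/2) * cnj z"
    and Im: "complex_of_real (Im z) = (- \<i>/2) * z + (\<i>/2) * cnj z" for z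
    by (simp_all add: complex_eq_iff)
  have gz: "g z = Re z * g 1 + Im z * g \<i>" for z
  proof -
    interpret bounded_linear g by fact
    have "z = Re z *\<^sub>R 1 + Im z *\<^sub>R \<i>" by (simp add: complex_eq_iff)
    then have "g z = g (Re z *\<^sub>R 1 + Im z *\<^sub>R \<i>)" by (rule arg_cong)
    then show ?thesis by (simp only: add scaleR real_scaleR_def)
  qed
  have gz': "complex_of_real (g z) = of_real (g 1) * ((1/2) * z + (1/2) * cnj z)
      + of_real (g \<i>) * ((- \<i>/2) * z + (\<i>/2) * cnj z)" for z
    unfolding Re[symmetric] Im[symmetric] by (subst gz) (simp add: mult.commute)
  then have "(\<lambda>t. complex_of_real (g (fourier_char 1 t))) =
    (\<lambda>t. of_real (g 1) * ((1/2) * fourier_char 1 t + (1/2) * fourier_char (-1) t)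
      + of_real (g \<i>) * ((- \<i>/2) * fourier_char 1 t + (\<i>/2) * fourier_char (-1) t))"
    using gz'[of "fourier_char 1 _"] unfolding cnj by (intro ext)
  also have "\<dots> \<in> trig_polys"
    by (intro trig_polys_add trig_polys_scale trig_polys_char)
  finally show ?case .
next
  case (const c)
  show ?case by (rule trig_polys_const)
next
  case (add f g)
  then show ?case using trig_polys_add by simp
next
  case (mult f g)
  then show ?case using trig_polys_mult by simp
qed

text \<open>Stone-Weierstrass on the unit circle gives uniform approximation, which bounds the mean
  square error because the measure has mass 1.\<close>

lemma continuous_comp_char_in_closure:
  assumes g: "continuous_on UNIV (g :: complex \<Rightarrow> real)"
  shows "(\<lambda>t. of_real (g (fourier_char 1 t))) \<in> L2_closure unit_uniform trig_polys"
proof -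
  interpret prob_space unit_uniform by (rule prob_space_unit_uniform)
  define f where "f t = complex_of_real (g (fourier_char 1 t))" for t
  have [measurable]: "g \<in> borel_measurable borel" using g by (rule borel_measurable_continuous_onI)
  have f_meas [measurable]: "f \<in> borel_measurable borel" unfolding f_def by measurable
  have approx: "\<exists>p\<in>trig_polys. in_L2 unit_uniform (\<lambda>t. f t - p t) \<and>
      (\<integral>t. (cmod (f t - p t))\<^sup>2 \<partial>unit_uniform) < \<epsilon>" if "\<epsilon> > 0" for \<epsilon>
  proof -
    define \<delta> where "\<delta> = sqrt (\<epsilon> / 2)"
    have "\<delta> > 0" "\<delta>\<^sup>2 < \<epsilon>" using that by (simp_all add: \<delta>_def)
    obtain q where q: "real_polynomial_function q" "\<And>z. z \<in> sphere 0 1 \<Longrightarrow> \<bar>g z - q z\<bar> < \<delta>"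
      using Stone_Weierstrass_real_polynomial_function[of "sphere 0 1" g \<delta>] \<open>\<delta> > 0\<close>
        continuous_on_subset[OF g subset_UNIV] by auto
    define p where "p t = complex_of_real (q (fourier_char 1 t))" for t
    have p: "p \<in> trig_polys" unfolding p_def by (rule real_polynomial_function_trig_poly[OF q(1)])
    then have [measurable]: "p \<in> borel_measurable borel"
      using in_L2_trig_poly[of p] by (simp add: in_L2_def measurable_unit_uniform)
    have bound: "cmod (f t - p t) \<le> \<delta>" for t
      using q(2)[of "fourier_char 1 t"]
      by (simp add: f_def p_def fourier_char_def flip: of_real_diff)
    then have L2: "in_L2 unit_uniform (\<lambda>t. f t - p t)" by (intro in_L2_bounded) auto
    have "(\<integral>t. (cmod (f t - p t))\<^sup>2 \<partial>unit_uniform) \<le> \<delta>\<^sup>2"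
      using L2 bound by (intro integral_le_const) (auto simp: in_L2_def intro!: power_mono)
    then show ?thesis using p L2 \<open>\<delta>\<^sup>2 < \<epsilon>\<close> by (intro bexI[of _ p]) auto
  qed
  have "in_L2 unit_uniform f"
  proof -
    obtain p where p: "p \<in> trig_polys" "in_L2 unit_uniform (\<lambda>t. f t - p t)" using approx[of 1] by auto
    have "in_L2 unit_uniform (\<lambda>t. (f t - p t) + p t)"
      by (rule in_L2_add[OF p(2) in_L2_trig_poly[OF p(1)]])
    then show ?thesis by simp
  qed
  moreover have "\<exists>p\<in>trig_polys. in_L2 unit_uniform p \<and> (\<integral>t. (cmod (f t - p t))\<^sup>2 \<partial>unit_uniform) < \<epsilon>"
    if "\<epsilon> > 0" for \<epsilon>
    using approx[OF that] in_L2_trig_poly by blast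
  ultimately show ?thesis unfolding L2_closure_def f_def[abs_def] by blast
qed

lemma indicator_open_in_closure:
  assumes "open V"
  shows "(\<lambda>t. of_real (indicator V (fourier_char 1 t))) \<in> L2_closure unit_uniform trig_polys"
\<comment> \<open>\<open>infdist\<close> to the empty set is 0 by convention, so the distance
  functions below fail when the complement is empty.\<close>
proof (cases "V = UNIV")
  case True
  then show ?thesis
    using continuous_comp_char_in_closure[of "\<lambda>_. 1"] by simp
next
  case False
  interpret prob_space unit_uniform by (rule prob_space_unit_uniform)
  have [measurable]: "V \<in> sets borel" using assms by simp
  \<comment> \<open>Continuous functions vanishing off \<open>V\<close> and increasing to its
    indicator, since the complement of \<open>V\<close> is closed.\<close>
  define g where "g k z = min 1 (real k * infdist z (- V))" for k z
  show ?thesis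
  proof (rule L2_closure_dominated_limit)
    show "(\<lambda>t. complex_of_real (indicator V (fourier_char 1 t))) \<in> borel_measurable unit_uniform"
      by measurable
    show "(\<lambda>t. of_real (g k (fourier_char 1 t))) \<in> L2_closure unit_uniform trig_polys" for k
      unfolding g_def by (intro continuous_comp_char_in_closure continuous_intros)
    show "integrable unit_uniform (\<lambda>t. 1\<^sup>2 :: real)" by simp
    show "cmod (complex_of_real (g k (fourier_char 1 t))) \<le> 1" for k t
      by (simp add: g_def infdist_nonneg)
    show "(\<lambda>k. complex_of_real (g k (fourier_char 1 t))) \<longlonglongrightarrow> of_real (indicator V (fourier_char 1 t))" for t
    proof (intro tendsto_of_real)
      define z where "z = fourier_char 1 t"
      show "(\<lambda>k. g k (fourier_char 1 t)) \<longlonglongrightarrow> indicator V (fourier_char 1 t)"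
        unfolding z_def[symmetric]
      proof (cases "z \<in> V")
        case True
        then have pos: "infdist z (- V) > 0"
          using assms False by (intro infdist_pos_not_in_closed) auto
        have "eventually (\<lambda>k. g k z = 1) sequentially"
          using eventually_ge_at_top[of "nat \<lceil>1 / infdist z (- V)\<rceil>"]
        proof eventually_elim
          case (elim k)
          then have "1 / infdist z (- V) \<le> real k" by linarith
          then show ?case using pos by (simp add: g_def field_simps)
        qed
        then show "(\<lambda>k. g k z) \<longlonglongrightarrow> indicator V z"
          using True by (simp add: tendsto_eventually)
      qed (simp add: g_def)
    qed
  qed
qed

text \<open>A Dynkin argument: open sets form an intersection-stable generator, complements amount
  to 1 minus the indicator, and a disjoint union is the limit of finite sums bounded by 1.\<close>

lemma indicator_comp_char_in_closure:
  assumes "V \<in> sets borel"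
  shows "(\<lambda>t. of_real (indicator V (fourier_char 1 t))) \<in> L2_closure unit_uniform trig_polys"
proof -
  interpret prob_space unit_uniform by (rule prob_space_unit_uniform)
  have stable: "Int_stable {S :: complex set. open S}" by (auto simp: Int_stable_def)
  have subset_Pow: "{S :: complex set. open S} \<subseteq> Pow UNIV" by simp
  have V: "V \<in> sigma_sets UNIV {S. open S}" using assms by (simp add: sets_borel)
  show ?thesis
    using stable subset_Pow V
  proof (induction V rule: sigma_sets_induct_disjoint)
    case (basic A)
    then show ?case by (intro indicator_open_in_closure) simp
  next
    case empty
    show ?case using L2_closure_base[OF trig_polys_const[of 0]] in_L2_trig_poly[OF trig_polys_const[of 0]] by simp
  next
    case (compl A)
    have "(\<lambda>t. 1 + (-1) * complex_of_real (indicator A (fourier_char 1 t))) \<in> L2_closure unit_uniform trig_polys"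
      by (intro L2_closure_add[where P = trig_polys] L2_closure_scale[where P = trig_polys] L2_closure_base
        trig_polys_add trig_polys_scale trig_polys_const in_L2_trig_poly compl)
    then show ?case by (simp add: indicator_diff)
  next
    case (union A)
    have meas: "A i \<in> sets borel" for i using union by (auto simp: sets_borel)
    show ?case
    proof (rule L2_closure_dominated_limit)
      have [measurable]: "(\<Union>i. A i) \<in> sets borel" using meas by auto
      show "(\<lambda>t. complex_of_real (indicator (\<Union>i. A i) (fourier_char 1 t))) \<in> borel_measurable unit_uniform"
        by measurable
      show "(\<lambda>t. complex_of_real (indicator (\<Union>i<k. A i) (fourier_char 1 t))) \<in> L2_closure unit_uniform trig_polys" for k
      proof -
        have "(\<lambda>t. \<Sum>i<k. complex_of_real (indicator (A i) (fourier_char 1 t))) \<in> L2_closure unit_uniform trig_polys"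
          by (rule L2_closure_sum) (auto intro: trig_polys_add trig_polys_const union)
        moreover have "disjoint_family_on A {..<k}"
          using union(1) by (rule disjoint_family_on_mono[rotated]) simp
        ultimately show ?thesis by (simp add: indicator_UN_disjoint)
      qed
      show "(\<lambda>k. complex_of_real (indicator (\<Union>i<k. A i) (fourier_char 1 t)))
          \<longlonglongrightarrow> of_real (indicator (\<Union>i. A i) (fourier_char 1 t))" for t
        by (intro tendsto_of_real LIMSEQ_indicator_UN)
      show "integrable unit_uniform (\<lambda>t. 1\<^sup>2 :: real)" by simp
      show "cmod (complex_of_real (indicator (\<Union>i<k. A i) (fourier_char 1 t))) \<le> 1" for k t
        by (simp add: indicator_def)
    qed
  qed
qed

text \<open>The function is continuous off the closed nonnegative half-line and constantly 0 on
  it.\<close>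

lemma measurable_Arg2pi [measurable]: "Arg2pi \<in> borel_measurable borel"
proof -
  have eq: "Arg2pi = (\<lambda>z. if z \<in> \<real>\<^sub>\<ge>\<^sub>0 then 0 else Arg2pi z)"
    by (intro ext) (auto simp: Arg2pi_eq_0 nonneg_Reals_def)
  have "(\<lambda>z. if z \<in> \<real>\<^sub>\<ge>\<^sub>0 then 0 else Arg2pi z) \<in> borel_measurable borel"
    by (rule borel_measurable_continuous_on_if)
      (auto intro!: continuous_at_imp_continuous_on continuous_at_Arg2pi)
  then show ?thesis by (simp only: eq[symmetric])
qed

text \<open>\<open>Arg2pi\<close> has values from 0 inclusive to 2 pi exclusive, and the character 1
  at t is exp (2 pi i (1 - t)) with 1 - t in that range after scaling. So the circle map has a
  measurable inverse on the half-open interval.\<close>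

lemma Arg2pi_fourier_char:
  assumes "0 < t" "t \<le> 1"
  shows "1 - Arg2pi (fourier_char 1 t) / (2 * pi) = t"
proof -
  have "2 * pi * (1 - t) = 2 * pi * 1 + - (2 * pi * (real_of_int 1 * t))" by (simp add: algebra_simps)
  then have "cis (2 * pi * (1 - t)) = cis (2 * pi * 1) * fourier_char 1 t"
    by (simp only: fourier_char_def cis_mult)
  also have "cis (2 * pi * 1) = 1" by (rule cis_multiple_2pi) simp
  finally have "fourier_char 1 t = cis (2 * pi * (1 - t))" by simp
  then have "Arg2pi (fourier_char 1 t) = 2 * pi * (1 - t)"
    using assms by (intro Arg2pi_unique[of 1]) (simp_all add: cis_conv_exp)
  then show ?thesis by simp
qed

lemma AE_unit_uniform: "AE t in unit_uniform. 0 < t \<and> t \<le> 1"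
  unfolding unit_uniform_def by (subst AE_density) (auto simp: indicator_def)

lemma trig_polys_dense:
  assumes "in_L2 unit_uniform f"
  shows "f \<in> L2_closure unit_uniform trig_polys"
proof (rule L2_closure_eq_if_indicators[OF _ _ _ assms])
  fix E assume "E \<in> sets unit_uniform"
  then have [measurable]: "E \<in> sets borel" by simp
  interpret prob_space unit_uniform by (rule prob_space_unit_uniform)
  \<comment> \<open>Pulling \<open>V\<close> back along the circle map returns \<open>E\<close> on
    the half-open interval, hence almost everywhere.\<close>
  define V where "V = {z. 1 - Arg2pi z / (2 * pi) \<in> E}"
  have [measurable]: "V \<in> sets borel" unfolding V_def by measurable
  have clos: "(\<lambda>t. of_real (indicator V (fourier_char 1 t))) \<in> L2_closure unit_uniform trig_polys"
    by (rule indicator_comp_char_in_closure) measurable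
  show "(\<lambda>t. of_real (indicator E t)) \<in> L2_closure unit_uniform trig_polys"
  proof (rule L2_closure_limit)
    show "in_L2 unit_uniform (\<lambda>t. of_real (indicator E t))"
      by (rule in_L2_bounded[of _ 1]) (auto simp: indicator_def)
    have "(\<integral>t. (cmod (of_real (indicator E t) - of_real (indicator V (fourier_char 1 t))))\<^sup>2 \<partial>unit_uniform)
        = (\<integral>t. 0 \<partial>unit_uniform)"
    proof (rule integral_cong_AE)
      show "AE t in unit_uniform. (cmod (of_real (indicator E t) - of_real (indicator V (fourier_char 1 t))))\<^sup>2 = 0"
        using AE_unit_uniform by eventually_elim (simp add: V_def indicator_def Arg2pi_fourier_char)
    qed measurable
    then show "\<exists>g\<in>L2_closure unit_uniform trig_polys.
        (\<integral>t. (cmod (of_real (indicator E t) - g t))\<^sup>2 \<partial>unit_uniform) < \<epsilon>" if "\<epsilon> > 0" for \<epsilon>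
      using that clos by (intro bexI[OF _ clos]) simp
  qed
qed (auto intro: trig_polys_add trig_polys_scale)

section \<open>Spectra\<close>

lemma measurable_exponential [measurable]: "exponential \<xi> \<in> borel_measurable borel"
  unfolding exponential_def by (intro borel_measurable_continuous_onI continuous_intros)

lemma exponential_axis_embed:
  "exponential \<xi> (axis_embed t) = exp (- 2 * complex_of_real pi * \<i> * of_real (\<xi> $ 1 * t))"
  by (simp add: exponential_def inner_vec_def sum_2)

lemma integral_segment_law:
  fixes f :: "real^2 \<Rightarrow> 'b::{banach, second_countable_topology}"
  assumes "f \<in> borel_measurable borel"
  shows "(\<integral>x. f x \<partial>segment_law) = (\<integral>t. f (axis_embed t) \<partial>unit_uniform)"
  unfolding segment_law_def using assms by (intro integral_distr) auto

lemma in_L2_segment_law: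
  assumes "in_L2 segment_law f"
  shows "in_L2 unit_uniform (\<lambda>t. f (axis_embed t))"
proof -
  have [measurable]: "f \<in> borel_measurable borel" using assms by (simp add: in_L2_def cong: measurable_cong_sets)
  then show ?thesis using assms unfolding in_L2_def segment_law_def by (subst (asm) integrable_distr_eq) auto
qed

lemma integral_unit_uniform:
  fixes f :: "real \<Rightarrow> complex"
  assumes "f \<in> borel_measurable borel"
  shows "(\<integral>t. f t \<partial>unit_uniform) = (\<integral>t. indicator {0..1} t *\<^sub>R f t \<partial>lborel)"
proof -
  have "unit_uniform = density lborel (\<lambda>t. ennreal (indicator {0<..1} t))"
    by (simp add: unit_uniform_def ennreal_indicator)
  then have "(\<integral>t. f t \<partial>unit_uniform) = (\<integral>t. f t \<partial>density lborel (\<lambda>t. ennreal (indicator {0<..1} t)))"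
    by (rule arg_cong)
  also have "\<dots> = (\<integral>t. indicator {0<..1} t *\<^sub>R f t \<partial>lborel)"
    using assms by (intro integral_density) auto
  also have "\<dots> = (\<integral>t. indicator {0..1} t *\<^sub>R f t \<partial>lborel)"
  proof (rule integral_cong_AE)
    show "AE t in lborel. indicator {0<..1} t *\<^sub>R f t = indicator {0..1} t *\<^sub>R f t"
      using AE_lborel_singleton[of "0::real"] by eventually_elim (auto simp: indicator_def)
  qed (use assms in measurable)
  finally show ?thesis .
qed

text \<open>The axis hides second coordinates, so only d enters; the value is the Fourier transform
  of the uniform law, the integral of exp (w t) over the unit interval.\<close>

lemma inner_exponential:
  assumes d: "d = \<xi> $ 1 - \<eta> $ 1"
  shows "inner_L2 segment_law (exponential \<xi>) (exponential \<eta>) =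
    (if d = 0 then 1 else (exp (- 2 * complex_of_real pi * \<i> * of_real d) - 1) / (- 2 * complex_of_real pi * \<i> * of_real d))"
proof -
  define w where "w = - 2 * complex_of_real pi * \<i> * of_real d"
  have "inner_L2 segment_law (exponential \<xi>) (exponential \<eta>) =
      (\<integral>t. exponential \<xi> (axis_embed t) * cnj (exponential \<eta> (axis_embed t)) \<partial>unit_uniform)"
    unfolding inner_L2_def by (rule integral_segment_law) measurable
  also have "\<dots> = (\<integral>t. exp (w * of_real t) \<partial>unit_uniform)"
    by (intro Bochner_Integration.integral_cong refl)
      (simp add: exponential_axis_embed exp_cnj d w_def algebra_simps flip: exp_add)
  also have "\<dots> = (if d = 0 then 1 else (exp w - 1) / w)"
  proof (cases "d = 0")
    case True
    interpret prob_space unit_uniform by (rule prob_space_unit_uniform)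
    show ?thesis using True prob_space by (simp add: w_def)
  next
    case False
    then have "w \<noteq> 0" by (simp add: w_def)
    have "(\<integral>t. exp (w * of_real t) \<partial>unit_uniform) = (\<integral>t. indicator {0..1} t *\<^sub>R exp (w * of_real t) \<partial>lborel)"
      by (intro integral_unit_uniform borel_measurable_continuous_onI continuous_intros)
    also have "\<dots> = exp (w * of_real 1) / w - exp (w * of_real 0) / w"
    proof (rule integral_FTC_Icc)
      show "((\<lambda>t. exp (w * of_real t) / w) has_vector_derivative exp (w * of_real t)) (at t within {0..1})" for t
        using \<open>w \<noteq> 0\<close> by (auto intro!: derivative_eq_intros has_vector_derivative_real_field)
    qed (auto intro!: continuous_intros)
    finally show ?thesis using False by (simp add: diff_divide_distrib)
  qed
  finally show ?thesis by (simp add: w_def)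
qed

lemma exp_2pi_eq_1_iff: "exp (- 2 * complex_of_real pi * \<i> * of_real d) = 1 \<longleftrightarrow> d \<in> \<int>"
proof
  assume "exp (- 2 * complex_of_real pi * \<i> * of_real d) = 1"
  then obtain n :: int where "- (2 * pi * d) = of_int (2 * n) * pi" by (auto simp: exp_eq_1)
  then have "2 * pi * d = 2 * pi * of_int (- n)" by simp
  then have "d = of_int (- n)" by (subst (asm) mult_left_cancel) auto
  then show "d \<in> \<int>" by (metis Ints_of_int)
next
  assume "d \<in> \<int>"
  then obtain n :: int where "d = of_int n" by (elim Ints_cases)
  then show "exp (- 2 * complex_of_real pi * \<i> * of_real d) = 1"
    by (auto simp: exp_eq_1 intro!: exI[of _ "- n"])
qed

lemma inner_exponential_eq_0_iff:
  "inner_L2 segment_law (exponential \<xi>) (exponential \<eta>) = 0 \<longleftrightarrow> \<xi> $ 1 - \<eta> $ 1 \<in> \<int> \<and> \<xi> $ 1 \<noteq> \<eta> $ 1"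
  using exp_2pi_eq_1_iff[of "\<xi> $ 1 - \<eta> $ 1"] by (simp add: inner_exponential[OF refl])

lemma upper_beurling_density_spectrum_le:
  assumes "is_spectrum segment_law \<Lambda>"
  shows "upper_beurling_density 1 \<Lambda> \<le> 2"
proof -
  have orth: "\<xi> $ 1 - \<eta> $ 1 \<in> \<int> \<and> \<xi> $ 1 \<noteq> \<eta> $ 1" if "\<xi> \<in> \<Lambda>" "\<eta> \<in> \<Lambda>" "\<xi> \<noteq> \<eta>" for \<xi> \<eta>
    using assms that unfolding is_spectrum_def orthonormal_basis_L2_def
    by (simp flip: inner_exponential_eq_0_iff)
  have count: "finite (\<Lambda> \<inter> ball x h) \<and> real (card (\<Lambda> \<inter> ball x h)) \<le> 2 * h + 1" if "h > 0" for x h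
  proof (cases "\<Lambda> \<inter> ball x h = {}")
    case True
    then show ?thesis using that by simp
  next
    case False
    then obtain \<eta> where \<eta>: "\<eta> \<in> \<Lambda> \<inter> ball x h" by blast
    \<comment> \<open>Relative to the base point the first coordinates are integers;
      \<open>floor\<close> merely changes their type. Orthogonality makes them distinct, so
      \<open>k\<close> counts faithfully.\<close>
    define k where "k \<xi> = \<lfloor>\<xi> $ 1 - \<eta> $ 1\<rfloor>" for \<xi> :: "real^2"
    have k: "real_of_int (k \<xi>) = \<xi> $ 1 - \<eta> $ 1" if "\<xi> \<in> \<Lambda> \<inter> ball x h" for \<xi>
      using orth[of \<xi> \<eta>] that \<eta> unfolding k_def by (cases "\<xi> = \<eta>") (auto simp: floor_of_int elim!: Ints_cases)
    have inj: "inj_on k (\<Lambda> \<inter> ball x h)"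
    proof (rule inj_onI)
      fix \<xi> \<zeta> assume "\<xi> \<in> \<Lambda> \<inter> ball x h" "\<zeta> \<in> \<Lambda> \<inter> ball x h" "k \<xi> = k \<zeta>"
      then show "\<xi> = \<zeta>" using k[of \<xi>] k[of \<zeta>] orth[of \<xi> \<zeta>] by auto
    qed
    have diam: "real_of_int (m - n) \<le> 2 * h" if "m \<in> k ` (\<Lambda> \<inter> ball x h)" "n \<in> k ` (\<Lambda> \<inter> ball x h)" for m n
    proof -
      obtain \<xi> \<zeta> where *: "\<xi> \<in> \<Lambda> \<inter> ball x h" "\<zeta> \<in> \<Lambda> \<inter> ball x h" "m = k \<xi>" "n = k \<zeta>"
        using \<open>m \<in> _\<close> \<open>n \<in> _\<close> by blast
      have "dist \<xi> \<zeta> < 2 * h" using *(1,2) by (intro dist_less_in_ball) auto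
      then show ?thesis
        using component_le_norm_cart[of "\<xi> - \<zeta>" 1] k[OF *(1)] k[OF *(2)] *(3,4) by (simp add: dist_norm)
    qed
    show ?thesis
      using card_int_diameter_le[of "k ` (\<Lambda> \<inter> ball x h)", OF diam] \<open>h > 0\<close> inj
      by (simp add: finite_image_iff card_image)
  qed
  have "upper_beurling_density 1 \<Lambda> \<le> ennreal 2"
  proof (rule upper_beurling_density_le)
    show "((\<lambda>h::real. (2 * h + 1) / h powr 1) \<longlongrightarrow> 2) at_top" by real_asymp
  qed (use count in auto)
  then show ?thesis by simp
qed

text \<open>On the axis the exponential at the graph point over n is \<open>fourier_char n\<close>,
  whatever the value of \<open>f n\<close>; completeness is therefore that of the
  characters.\<close>

lemma is_spectrum_graph_set: "is_spectrum segment_law (graph_set f)"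
  unfolding is_spectrum_def orthonormal_basis_L2_def
proof (intro conjI ballI allI impI discrete_graph_set)
  interpret prob_space segment_law by (rule prob_space_segment_law)
  show "in_L2 segment_law (exponential \<xi>)" for \<xi>
    by (rule in_L2_bounded[of _ 1]) (auto simp: exponential_def)
  show "inner_L2 segment_law (exponential \<xi>) (exponential \<eta>) = (if \<xi> = \<eta> then 1 else 0)"
    if pts: "\<xi> \<in> graph_set f" "\<eta> \<in> graph_set f" for \<xi> \<eta>
  proof (cases "\<xi> = \<eta>")
    case True
    then show ?thesis by (simp add: inner_exponential[OF refl])
  next
    case False
    obtain m n where mn: "\<xi> = vector [real_of_int m, f m]" "\<eta> = vector [real_of_int n, f n]"
      using pts unfolding graph_set_def by blast
    then have "\<xi> $ 1 - \<eta> $ 1 \<in> \<int> \<and> \<xi> $ 1 \<noteq> \<eta> $ 1" using False by (auto simp flip: of_int_diff)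
    then show ?thesis using False inner_exponential_eq_0_iff by simp
  qed
  fix g :: "real^2 \<Rightarrow> complex" and \<epsilon> :: real
  assume g: "in_L2 segment_law g" and "\<epsilon> > 0"
  have [measurable]: "g \<in> borel_measurable borel" using g by (simp add: in_L2_def cong: measurable_cong_sets)
  obtain p where p: "p \<in> trig_polys" "(\<integral>t. (cmod (g (axis_embed t) - p t))\<^sup>2 \<partial>unit_uniform) < \<epsilon>\<^sup>2"
    using L2_closureE[OF trig_polys_dense[OF in_L2_segment_law[OF g]], of "\<epsilon>\<^sup>2"] \<open>\<epsilon> > 0\<close> by auto
  obtain F c where F: "finite F" "p = (\<lambda>t. \<Sum>n\<in>F. c n * fourier_char n t)"
    using p(1) by (auto simp: trig_polys_def)
  define pt where "pt n = (vector [real_of_int n, f n] :: real^2)" for n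
  have inj: "inj_on pt F" unfolding pt_def by (rule inj_on_subset[OF inj_graph subset_UNIV])
  \<comment> \<open>The floor of the first coordinate recovers the integer index, moving the
    coefficients from indices to graph points.\<close>
  define c' where "c' \<xi> = c \<lfloor>\<xi> $ 1\<rfloor>" for \<xi> :: "real^2"
  have "c' (pt n) * exponential (pt n) (axis_embed t) = c n * fourier_char n t" for n t
    by (simp add: c'_def pt_def exponential_axis_embed fourier_char_def cis_conv_exp mult_ac)
  then have "(\<Sum>\<xi>\<in>pt ` F. c' \<xi> * exponential \<xi> (axis_embed t)) = p t" for t
    using inj by (simp add: F(2) sum.reindex)
  moreover have "(\<integral>x. (cmod (g x - (\<Sum>\<xi>\<in>pt ` F. c' \<xi> * exponential \<xi> x)))\<^sup>2 \<partial>segment_law) =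
      (\<integral>t. (cmod (g (axis_embed t) - (\<Sum>\<xi>\<in>pt ` F. c' \<xi> * exponential \<xi> (axis_embed t))))\<^sup>2 \<partial>unit_uniform)"
    by (rule integral_segment_law) measurable
  ultimately have "norm_L2 segment_law (\<lambda>x. g x - (\<Sum>\<xi>\<in>pt ` F. c' \<xi> * exponential \<xi> x)) < sqrt (\<epsilon>\<^sup>2)"
    unfolding norm_L2_def using real_sqrt_less_mono[OF p(2)] by simp
  then show "\<exists>F c. finite F \<and> F \<subseteq> graph_set f \<and>
      norm_L2 segment_law (\<lambda>x. g x - (\<Sum>i\<in>F. c i * exponential i x)) < \<epsilon>"
    using F(1) \<open>\<epsilon> > 0\<close> by (intro exI[of _ "pt ` F"] exI[of _ c']) (auto simp: pt_def graph_set_def)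
qed

theorem proposition4p1:
  fixes R :: "real^2^2" and B :: "(real^2) set" and \<mu> :: "(real^2) measure"
  assumes "R = vector [vector [2, 1], vector [0, 2]]"
    and "B = {vector [0, 0], vector [1, 0]}"
    and "\<mu> = self_affine_measure R B"
  shows "(\<forall>\<Lambda>. is_spectrum \<mu> \<Lambda> \<longrightarrow> upper_beurling_density 1 \<Lambda> \<le> 2) \<and>
    (\<exists>\<Lambda>. is_spectrum \<mu> \<Lambda> \<and> upper_beurling_density 1 \<Lambda> = 2) \<and>
    (\<forall>s::real. 0 \<le> s \<and> s \<le> 2 \<longrightarrow>
       (\<exists>\<Lambda>. is_spectrum \<mu> \<Lambda> \<and> beurling_dim \<Lambda> = 1 \<and> upper_beurling_density 1 \<Lambda> = ennreal s))"
proof -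
  have mu: "\<mu> = segment_law" using assms self_affine_measure_eq_segment_law by simp
  have all: "\<exists>\<Lambda>. is_spectrum \<mu> \<Lambda> \<and> beurling_dim \<Lambda> = 1 \<and> upper_beurling_density 1 \<Lambda> = ennreal s"
    if s: "0 \<le> s" "s \<le> 2" for s :: real
  proof (cases "s = 0")
    case True
    then show ?thesis unfolding mu
      by (intro exI[of _ "graph_set nlogn"])
        (simp add: is_spectrum_graph_set beurling_dim_nlogn upper_beurling_density_nlogn)
  next
    case False
    \<comment> \<open>The solution of 2 / sqrt (1 + c^2) = s, real because s is at most 2; the
      extreme value s = 2 gives c = 0, the integers on the axis.\<close>
    define c where "c = sqrt ((2 / s)\<^sup>2 - 1)"
    have "s > 0" using s False by simp
    then have "(2 / s)\<^sup>2 \<ge> 1" using s by (intro one_le_power) simp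
    then have "sqrt (1 + c\<^sup>2) = 2 / s" using \<open>s > 0\<close> by (simp add: c_def)
    then have "upper_beurling_density 1 (graph_set (\<lambda>n. c * real_of_int n)) = ennreal s"
      using \<open>s > 0\<close> by (simp add: upper_beurling_density_line)
    then show ?thesis unfolding mu using is_spectrum_graph_set beurling_dim_line by blast
  qed
  have "\<exists>\<Lambda>. is_spectrum \<mu> \<Lambda> \<and> upper_beurling_density 1 \<Lambda> = 2"
    using all[of 2] by auto
  then show ?thesis using all upper_beurling_density_spectrum_le unfolding mu by blast
qed

end
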